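(* Let $(L,\mathcal G)$ be a nestoid. Then $$\operatorname*{Res}_{E_{\hat 1}^+=0}\Psi(L,\mathcal G)=A_E(L,\mathcal G),$$ where $A_E(L,\mathcal G)$ is the Laplace transform of $\Sigma^{2\mathcal G}/\langle\hat 1^+,\hat 1^-\rangle$, i.e. the nestoid amplitude $A(L,\mathcal G)$ under the substitution $s_f=E_f^+E_f^-$.
   Context: All lattices are finite. Let $L$ be a lattice with minimum $\hat 0$ and maximum $\hat 1$. A subset $\mathcal G\subseteq L_{>\hat 0}$ is nestable if $\hat 1\in\mathcal G$ and for any two incomparable $f,g\in\mathcal G$, $f\vee g\notin\mathcal G$ implies $f\wedge g=\hat 0$. A subset $N\subseteq\mathcal G$ is nested if for all $k\ge 2$ and pairwise incomparable $f_1,\dots,f_k\in N$ one has $f_1\vee\dots\vee f_k\notin\mathcal G$. $\mathcal N(L,\mathcal G)$ is the simplicial complex of nested sets. $(L,\mathcal G)$ is a nestoid if $\mathcal G$ is nestable and for every $f\in\mathcal G$ the complex $\mathcal N([\hat 0,f],\mathcal G\cap[\hat 0,f])$ is pure. $\mathbb R^{2\mathcal G}$ is the real vector space with basis $f^+,f^-$ ($f\in\mathcal G$), with the lattice spanned by this basis; $p_f,m_f$ are the dual coordinates. For a nested set $N$, $\mathbb R_+^{2N}$ is the cone spanned by $f^+,f^-$, $f\in N$. The fan $\Sigma^{2\mathcal G}$ consists of all faces of the cones $\mathbb R_+^{2N}$, $N\in\mathcal N(L,\mathcal G)$. For $g\in\mathcal G$ put $F_g:=p_{\hat 1}+\sum_{f\in\mathcal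 G,\ g<f<\hat 1}(p_f-m_f)-m_g$. The causal cone is $\{m_{\hat 1}=0,\ p_g\ge0,\ m_g\ge0,\ F_g\ge 0\ \forall g\in\mathcal G\}$. The universe fan $\mathcal U_{\mathcal G}$ is obtained by intersecting the cones of $\Sigma^{2\mathcal G}$ with the causal cone (its cones are these intersections and all their faces). For a fan $\Sigma$ and a cone $\tau\in\Sigma$ with generators $v_1,\dots,v_r$, $\Sigma/\langle v_1,\dots,v_r\rangle$ is the link: the fan in the quotient by $\mathrm{span}(v_1,\dots,v_r)$ consisting of the images of the cones containing $\tau$. The Laplace transform of a fan is $\sum_C\int_C e^{-x\cdot y}\,dx$, the sum over maximal cones $C$, where each integral is taken with respect to the measure on $\mathrm{span}(C)$ normalized by the lattice and regarded as a rational function of $y$. The wavefunction $\Psi(L,\mathcal G)$ is the Laplace transform of $\mathcal U_{\mathcal G}$, a rational function in variables $E_f^\pm$ corresponding to the basis vectors $f^\pm$. The nestoid amplitude is $A(L,\mathcal G)=\sum_N\prod_{f\in N\setminus\{\hat 1\}}\frac1{s_f}$, the sum over maximal nested sets $N$; thus $A_E(L,\mathcal G)=\sum_N\prod_{f\in N\setminus\{\hat 1\}}\frac1{E_f^+E_f^-}$. $\operatorname*{Res}_{E_{\hat 1}^+=0}\Psi$ is the restriction of $E_{\hat 1}^+\Psi$ to $E_{\hat 1}^+=0$. *)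

theory Defs
  imports "HOL-Analysis.Analysis" "HOL-Computational_Algebra.Fraction_Field"
begin

section \<open>Rational functions in variables indexed by a finite type\<close>

text \<open>
  Since the reals are infinite, polynomials in the variables \<open>y $ i\<close> are the same thing as
  polynomial functions on \<open>real ^ 'n\<close>.  They form an integral domain, and the rational functions
  are the elements of its fraction field.
\<close>

lemma real_polynomial_function_eq_0:
  fixes f :: "real ^ 'n \<Rightarrow> real"
  assumes f: "real_polynomial_function f" and U: "open U" "a \<in> U"
    and zero: "\<And>y. y \<in> U \<Longrightarrow> f y = 0"
  shows "f b = 0"
proof -
  define l where "l = (\<lambda>t::real. a + t *\<^sub>R (b - a))"
  have l: "polynomial_function l"
    unfolding l_def
    by (intro polynomial_function_add polynomial_function_const polynomial_function_mult)
       (simp add: real_polynomial_function_eq[symmetric] real_polynomial_function.intros(1))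
  have "real_polynomial_function (f \<circ> l)"
    by (rule real_polynomial_function_compose[OF l f])
  then obtain c n where "f \<circ> l = (\<lambda>t. \<Sum>i\<le>n. c i * t ^ i)"
    unfolding real_polynomial_function_iff_sum by blast
  then have c: "f (l t) = (\<Sum>i\<le>n. c i * t ^ i)" for t
    by (metis comp_apply)
  have "continuous_on UNIV l"
    unfolding l_def by (intro continuous_intros)
  then have "open (l -` U)"
    using U(1) by (simp add: open_vimage)
  moreover have "0 \<in> l -` U"
    using U(2) by (simp add: l_def)
  ultimately obtain e where e: "e > 0" "ball 0 e \<subseteq> l -` U"
    by (meson open_contains_ball)
  have "ball 0 e \<subseteq> {t. (\<Sum>i\<le>n. c i * t ^ i) = 0}"
  proof
    fix t assume "t \<in> ball (0::real) e"
    then have "f (l t) = 0"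
      using e(2) zero by blast
    then show "t \<in> {t. (\<Sum>i\<le>n. c i * t ^ i) = 0}"
      by (simp add: c)
  qed
  moreover have "infinite (ball (0::real) e)"
    using e(1) by (simp add: ball_eq_greaterThanLessThan infinite_Ioo)
  ultimately have inf: "infinite {t. (\<Sum>i\<le>n. c i * t ^ i) = 0}"
    using finite_subset by blast
  have "c i = 0" if "i \<le> n" for i
  proof (rule ccontr)
    assume "c i \<noteq> 0"
    from polyfun_roots_finite[of c i n, OF this that] inf show False by simp
  qed
  then have "f (l 1) = 0"
    by (simp add: c)
  then show ?thesis
    by (simp add: l_def)
qed

typedef 'n mpoly = "{f :: real ^ 'n \<Rightarrow> real. real_polynomial_function f}"
  morphisms eval Mpoly
  by (rule exI[of _ "\<lambda>_. 0"]) auto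

setup_lifting type_definition_mpoly

instantiation mpoly :: (finite) comm_ring_1
begin
lift_definition zero_mpoly :: "'a mpoly" is "\<lambda>_. 0" by auto
lift_definition one_mpoly :: "'a mpoly" is "\<lambda>_. 1" by auto
lift_definition plus_mpoly :: "'a mpoly \<Rightarrow> 'a mpoly \<Rightarrow> 'a mpoly" is "\<lambda>f g y. f y + g y" by auto
lift_definition minus_mpoly :: "'a mpoly \<Rightarrow> 'a mpoly \<Rightarrow> 'a mpoly" is "\<lambda>f g y. f y - g y" by auto
lift_definition uminus_mpoly :: "'a mpoly \<Rightarrow> 'a mpoly" is "\<lambda>f y. - f y" by auto
lift_definition times_mpoly :: "'a mpoly \<Rightarrow> 'a mpoly \<Rightarrow> 'a mpoly" is "\<lambda>f g y. f y * g y" by auto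
instance
  by standard (transfer, simp add: algebra_simps fun_eq_iff)+
end

lemma eval_eq_0:
  assumes "open U" "U \<noteq> {}" "\<And>y. y \<in> U \<Longrightarrow> eval P y = 0"
  shows "P = 0"
proof -
  obtain a where "a \<in> U" using assms(2) by blast
  have "real_polynomial_function (eval P)"
    using eval[of P] by simp
  from real_polynomial_function_eq_0[OF this assms(1) \<open>a \<in> U\<close> assms(3)]
  have "eval P = eval 0"
    by (simp add: fun_eq_iff zero_mpoly.rep_eq)
  then show ?thesis
    by (simp add: eval_inject)
qed

instance mpoly :: (finite) idom
proof
  fix P Q :: "'a mpoly"
  assume "P \<noteq> 0" "Q \<noteq> 0"
  define U where "U = {y. eval P y \<noteq> 0}"
  have "continuous_on UNIV (eval P)"
    using eval[of P] by (simp add: continuous_on_polymonial_function real_polynomial_function_eq)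
  then have U: "open U"
    unfolding U_def by (intro open_Collect_neq) auto
  have "U \<noteq> {}"
    using \<open>P \<noteq> 0\<close> eval_eq_0[OF open_UNIV, of P] by (auto simp: U_def)
  then obtain y where "y \<in> U" "eval Q y \<noteq> 0"
    using eval_eq_0[OF U] \<open>Q \<noteq> 0\<close> by metis
  then have "eval (P * Q) y \<noteq> 0"
    by (simp add: U_def times_mpoly.rep_eq)
  then show "P * Q \<noteq> 0"
    by (metis zero_mpoly.rep_eq)
qed

type_synonym 'n ratfun = "'n mpoly fract"

lift_definition mvar :: "'n::finite \<Rightarrow> 'n mpoly" is "\<lambda>i y. y $ i"
  by (intro real_polynomial_function.intros(1) bounded_linear_vec_nth)

definition rvar :: "'n::finite \<Rightarrow> 'n ratfun" where
  "rvar i = Fract (mvar i) 1"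

lift_definition restrict_poly :: "'n::finite \<Rightarrow> 'n mpoly \<Rightarrow> 'n mpoly"
  is "\<lambda>i f y. f (\<chi> j. if j = i then 0 else y $ j)"
proof -
  fix i and f :: "real ^ 'n \<Rightarrow> real"
  assume f: "real_polynomial_function f"
  have "bounded_linear (\<lambda>y::real ^ 'n. \<chi> j. if j = i then 0 else y $ j)"
    by (intro linear_conv_bounded_linear[THEN iffD1] linearI) (auto simp: vec_eq_iff)
  then have "polynomial_function (\<lambda>y::real ^ 'n. \<chi> j. if j = i then 0 else y $ j)"
    by (rule polynomial_function_bounded_linear)
  from real_polynomial_function_compose[OF this f]
  show "real_polynomial_function (\<lambda>y. f (\<chi> j. if j = i then 0 else y $ j))"
    by (simp add: o_def)
qed

text \<open>
  \<open>has_residue i R S\<close>: the rational function \<open>y\<^sub>i * R\<close> has a restriction to the hyperplane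
  \<open>y\<^sub>i = 0\<close> (that is, it can be written with a denominator not vanishing identically there),
  and this restriction is \<open>S\<close>.
\<close>

definition has_residue :: "'n::finite \<Rightarrow> 'n ratfun \<Rightarrow> 'n ratfun \<Rightarrow> bool" where
  "has_residue i R S \<longleftrightarrow>
     (\<exists>P Q. restrict_poly i Q \<noteq> 0 \<and> rvar i * R = Fract P Q \<and>
            S = Fract (restrict_poly i P) (restrict_poly i Q))"

lemma restrict_poly_0 [simp]: "restrict_poly i 0 = 0"
  by transfer simp

lemma restrict_poly_mult: "restrict_poly i (P * Q) = restrict_poly i P * restrict_poly i Q"
  by transfer simp

lemma has_residue_unique:
  assumes "has_residue i R S" "has_residue i R S'"
  shows "S = S'"
proof -
  from assms obtain P Q P' Q' where
    1: "restrict_poly i Q \<noteq> 0" "rvar i * R = Fract P Q"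
       "S = Fract (restrict_poly i P) (restrict_poly i Q)" and
    2: "restrict_poly i Q' \<noteq> 0" "rvar i * R = Fract P' Q'"
       "S' = Fract (restrict_poly i P') (restrict_poly i Q')"
    unfolding has_residue_def by blast
  have "Q \<noteq> 0" "Q' \<noteq> 0"
    using 1(1) 2(1) by auto
  then have "P * Q' = P' * Q"
    using 1(2) 2(2) by (simp add: eq_fract)
  then have "restrict_poly i P * restrict_poly i Q' = restrict_poly i P' * restrict_poly i Q"
    by (metis restrict_poly_mult)
  then show ?thesis
    using 1 2 by (simp add: eq_fract)
qed

text \<open>The rational function \<open>R\<close> represents the function \<open>h\<close> on the domain \<open>D\<close>.\<close>

definition represents :: "'n::finite ratfun \<Rightarrow> (real ^ 'n \<Rightarrow> real) \<Rightarrow> (real ^ 'n) set \<Rightarrow> bool" where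
  "represents R h D \<longleftrightarrow>
     (\<exists>P Q. Q \<noteq> 0 \<and> R = Fract P Q \<and> (\<forall>y\<in>D. eval Q y * h y = eval P y))"

lemma represents_unique:
  assumes "represents R h D" "represents R' h D" "interior D \<noteq> {}"
  shows "R = R'"
proof -
  from assms obtain P Q P' Q' where
    1: "Q \<noteq> 0" "R = Fract P Q" "\<And>y. y \<in> D \<Longrightarrow> eval Q y * h y = eval P y" and
    2: "Q' \<noteq> 0" "R' = Fract P' Q'" "\<And>y. y \<in> D \<Longrightarrow> eval Q' y * h y = eval P' y"
    unfolding represents_def by blast
  have "eval (P * Q' - P' * Q) y = 0" if "y \<in> interior D" for y
  proof -
    have "y \<in> D" using that interior_subset by blast
    then have "eval P y = eval Q y * h y" "eval P' y = eval Q' y * h y"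
      using 1(3) 2(3) by auto
    then show ?thesis
      by (simp add: minus_mpoly.rep_eq times_mpoly.rep_eq)
  qed
  then have "P * Q' - P' * Q = 0"
    using eval_eq_0[OF open_interior assms(3)] by blast
  then show ?thesis
    using 1 2 by (simp add: eq_fract)
qed


section \<open>Fans and their Laplace transforms\<close>

text \<open>Used both for facets of simplicial complexes and for maximal cones of fans.\<close>

definition maximal_members :: "'b set set \<Rightarrow> 'b set set" where
  "maximal_members K = {M \<in> K. \<forall>M'\<in>K. M \<subseteq> M' \<longrightarrow> M' = M}"

text \<open>
  The empty set is a face of every convex set in the sense of \<^const>\<open>face_of\<close>; it is not a cone.
\<close>

definition faces_of_cones :: "'v::real_vector set set \<Rightarrow> 'v set set" where
  "faces_of_cones K = {F. F \<noteq> {} \<and> (\<exists>C\<in>K. F face_of C)}"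

definition lattice_basis :: "'v::real_vector set \<Rightarrow> 'v set \<Rightarrow> 'v set \<Rightarrow> bool" where
  "lattice_basis \<Lambda> V B \<longleftrightarrow> finite B \<and> independent B \<and> span B = V \<and>
     \<Lambda> \<inter> V = {\<Sum>b\<in>B. of_int (k b) *\<^sub>R b | k :: 'v \<Rightarrow> int. True}"

text \<open>
  The Lebesgue measure on the subspace \<open>V\<close>, normalized so that a fundamental parallelepiped of the
  lattice \<open>\<Lambda> \<inter> V\<close> has measure 1.  It is independent of the basis, because two bases differ by an
  integer matrix of determinant 1 or -1.
\<close>

definition lattice_measure :: "'v::euclidean_space set \<Rightarrow> 'v set \<Rightarrow> 'v measure" where
  "lattice_measure \<Lambda> V =
     (let B = (SOME B. lattice_basis \<Lambda> V B)
      in distr (Pi\<^sub>M B (\<lambda>_. lborel)) borel (\<lambda>t. \<Sum>b\<in>B. t b *\<^sub>R b))"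

text \<open>
  The dual space is identified with the space itself by the standard inner product.  The integral
  converges for \<open>y\<close> in the interior of the dual cone, which is nonempty for pointed \<open>C\<close>; by
  \<open>represents_unique\<close> a rational function is determined by its values there.
\<close>

definition cone_laplace :: "(real ^ 'n::finite) set \<Rightarrow> (real ^ 'n) set \<Rightarrow> 'n ratfun" where
  "cone_laplace \<Lambda> C =
     (THE R. represents R
               (\<lambda>y. LINT x:C|lattice_measure \<Lambda> (span C). exp (- (x \<bullet> y)))
               {y. \<forall>x\<in>C. x \<noteq> 0 \<longrightarrow> 0 < x \<bullet> y})"

definition laplace :: "(real ^ 'n::finite) set \<Rightarrow> (real ^ 'n) set set \<Rightarrow> 'n ratfun" where
  "laplace \<Lambda> \<Sigma> = (\<Sum>C\<in>maximal_members \<Sigma>. cone_laplace \<Lambda> C)"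

text \<open>
  The quotient of the ambient space by a subspace \<open>W\<close> is modelled by the orthogonal complement of
  \<open>W\<close>, each coset of \<open>W\<close> by its unique representative there.  Dually, the functionals on the
  quotient are those on the ambient space that vanish on \<open>W\<close>, and they too form the orthogonal
  complement of \<open>W\<close>.  Accordingly, the Laplace transform of a fan in the quotient only involves
  the variables orthogonal to \<open>W\<close>.
\<close>

definition quotient_proj :: "'v::euclidean_space set \<Rightarrow> 'v \<Rightarrow> 'v" where
  "quotient_proj W x = (THE z. z \<in> W\<^sup>\<bottom> \<and> x - z \<in> W)"

definition link :: "'v::euclidean_space set set \<Rightarrow> 'v set \<Rightarrow> 'v set set" where
  "link \<Sigma> vs = {quotient_proj (span vs) ` C | C. C \<in> \<Sigma> \<and> convex_cone hull vs \<subseteq> C}"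


section \<open>Nestoids\<close>

text \<open>
  The finite lattice is the whole type.  The ambient space of all constructions below is
  \<open>real ^ ('a \<times> bool)\<close>, with \<open>f\<^sup>+\<close> and \<open>f\<^sup>-\<close> the basis vectors at \<open>(f, True)\<close> and \<open>(f, False)\<close>; the
  space with basis \<open>f\<^sup>+, f\<^sup>-\<close> for \<open>f \<in> G\<close> is a coordinate subspace of it.
\<close>

definition incomparable :: "'a::order \<Rightarrow> 'a \<Rightarrow> bool" where
  "incomparable f g \<longleftrightarrow> \<not> f \<le> g \<and> \<not> g \<le> f"

definition nestable :: "'a::bounded_lattice set \<Rightarrow> bool" where
  "nestable G \<longleftrightarrow> G \<subseteq> {bot<..} \<and> top \<in> G \<and>
     (\<forall>f\<in>G. \<forall>g\<in>G. incomparable f g \<and> sup f g \<notin> G \<longrightarrow> inf f g = bot)"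

text \<open>
  Joins in an interval \<open>[bot, f]\<close> are joins in the whole lattice, so the nested complex of
  \<open>([bot, f], G \<inter> [bot, f])\<close> is \<open>nested_sets (G \<inter> {bot..f})\<close>.
\<close>

definition nested_sets :: "'a::{finite, bounded_lattice} set \<Rightarrow> 'a set set" where
  "nested_sets G = {N. N \<subseteq> G \<and>
     (\<forall>S\<subseteq>N. 2 \<le> card S \<and> pairwise incomparable S \<longrightarrow> \<Squnion>\<^sub>f\<^sub>i\<^sub>n S \<notin> G)}"

definition pure :: "'b set set \<Rightarrow> bool" where
  "pure K \<longleftrightarrow> (\<forall>M\<in>maximal_members K. \<forall>M'\<in>maximal_members K. card M = card M')"

definition nestoid :: "'a::{finite, bounded_lattice} set \<Rightarrow> bool" where
  "nestoid G \<longleftrightarrow> nestable G \<and> (\<forall>f\<in>G. pure (nested_sets (G \<inter> {bot..f})))"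

definition nestoid_amplitude :: "'a::{finite, bounded_lattice} set \<Rightarrow> ('a \<Rightarrow> 'k::field) \<Rightarrow> 'k" where
  "nestoid_amplitude G s = (\<Sum>N\<in>maximal_members (nested_sets G). \<Prod>f\<in>N - {top}. 1 / s f)"


section \<open>The fans of a nestoid\<close>

abbreviation plus_vec :: "'a::finite \<Rightarrow> real ^ ('a \<times> bool)" where
  "plus_vec f \<equiv> axis (f, True) 1"

abbreviation minus_vec :: "'a::finite \<Rightarrow> real ^ ('a \<times> bool)" where
  "minus_vec f \<equiv> axis (f, False) 1"

abbreviation p_coord :: "real ^ ('a::finite \<times> bool) \<Rightarrow> 'a \<Rightarrow> real" where
  "p_coord x f \<equiv> x $ (f, True)"

abbreviation m_coord :: "real ^ ('a::finite \<times> bool) \<Rightarrow> 'a \<Rightarrow> real" where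
  "m_coord x f \<equiv> x $ (f, False)"

definition signed_basis :: "'a::finite set \<Rightarrow> (real ^ ('a \<times> bool)) set" where
  "signed_basis N = plus_vec ` N \<union> minus_vec ` N"

definition signed_lattice :: "'a::finite set \<Rightarrow> (real ^ ('a \<times> bool)) set" where
  "signed_lattice G = {\<Sum>b\<in>signed_basis G. of_int (k b) *\<^sub>R b | k :: real ^ ('a \<times> bool) \<Rightarrow> int. True}"

definition signed_fan :: "'a::{finite, bounded_lattice} set \<Rightarrow> (real ^ ('a \<times> bool)) set set" where
  "signed_fan G = faces_of_cones {convex_cone hull signed_basis N | N. N \<in> nested_sets G}"

definition F_form :: "'a::{finite, bounded_lattice} set \<Rightarrow> 'a \<Rightarrow> real ^ ('a \<times> bool) \<Rightarrow> real" where
  "F_form G g x =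
     p_coord x top + (\<Sum>f\<in>{f\<in>G. g < f \<and> f < top}. p_coord x f - m_coord x f) - m_coord x g"

definition causal_cone :: "'a::{finite, bounded_lattice} set \<Rightarrow> (real ^ ('a \<times> bool)) set" where
  "causal_cone G = {x \<in> span (signed_basis G). m_coord x top = 0 \<and>
     (\<forall>g\<in>G. 0 \<le> p_coord x g \<and> 0 \<le> m_coord x g \<and> 0 \<le> F_form G g x)}"

definition universe_fan :: "'a::{finite, bounded_lattice} set \<Rightarrow> (real ^ ('a \<times> bool)) set set" where
  "universe_fan G = faces_of_cones {C \<inter> causal_cone G | C. C \<in> signed_fan G}"

definition wavefunction :: "'a::{finite, bounded_lattice} set \<Rightarrow> ('a \<times> bool) ratfun" where
  "wavefunction G = laplace (signed_lattice G) (universe_fan G)"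

abbreviation E_plus :: "'a::finite \<Rightarrow> ('a \<times> bool) ratfun" where
  "E_plus f \<equiv> rvar (f, True)"

abbreviation E_minus :: "'a::finite \<Rightarrow> ('a \<times> bool) ratfun" where
  "E_minus f \<equiv> rvar (f, False)"

definition amplitude_E :: "'a::{finite, bounded_lattice} set \<Rightarrow> ('a \<times> bool) ratfun" where
  "amplitude_E G = nestoid_amplitude G (\<lambda>f. E_plus f * E_minus f)"

end

theory Submission
  imports Defs
begin

text \<open>
  Write \<open>e\<close> for the basis vector \<open>plus_vec top\<close>, so that \<open>E_plus top\<close> is the variable dual to it.

  The maximal cones of the universe fan are the intersections of the cones \<open>R\<^sub>+\<^sup>2\<^sup>N\<close> with the causal
  cone, one for each maximal nested set \<open>N\<close> (\<open>laplace_universe_fan\<close>).  The amplitude is a sum over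
  the same index set, so it suffices to find the residue of the Laplace transform of one such cone.

  In the coordinates belonging to \<open>N\<close>, this cone is an orthant cut by the inequalities \<open>F\<^sub>g \<ge> 0\<close>, and
  every \<open>F\<^sub>g\<close> takes the value 1 at \<open>e\<close>.  Hence every other basis vector \<open>b\<close> enters the cone when a
  large multiple of \<open>e\<close> is added to it.  The vectors \<open>b + \<kappa>\<^sub>b e\<close> together with \<open>e\<close> span a simplicial
  cone inside the given one, and what remains is dissected into simplicial cones none of whose
  generators is a multiple of \<open>e\<close>.  The Laplace transform of a simplicial cone, taken with respect to
  the measure carried over from the coefficients, is the product of the reciprocals of its generators,
  read as linear forms; so only the first cone has a pole along \<open>E_plus top = 0\<close>.  That pole is simple, and setting \<open>E_plus top\<close> to 0 turns \<open>b + \<kappa>\<^sub>b e\<close> into \<open>b\<close>; the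
  residue is the product of the \<open>1 / (E_plus f * E_minus f)\<close> for \<open>f \<in> N - {top}\<close>
  (\<open>residue_cone_laplace\<close>).

  The dissection needs a single move: the plane cone spanned by \<open>u\<close> and \<open>w\<close> is the union of the cones
  spanned by \<open>u, w + \<kappa> u\<close> and by \<open>u + w / \<kappa>, w\<close>.  Both pieces are images of the original one under
  shears, so the measure on each piece is again the one carried over from the coefficients
  (\<open>simplicial_integral_split\<close>).  Moreover the generators only ever change by positive combinations,
  which keeps them inside any convex cone that contains them.

  The maximal cones of the link are the images of the \<open>R\<^sub>+\<^sup>2\<^sup>N\<close> in the quotient, that is, the orthants on
  \<open>N - {top}\<close> (\<open>laplace_link\<close>), and their Laplace transforms are the summands of the amplitude.
\<close>

section \<open>Dissection of simplicial cones\<close>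

text \<open>
  The integral over the cone spanned by the \<open>v i\<close>, with the measure carried over from the coefficient
  space.  Using the coefficients rather than the points keeps a family \<open>v\<close> and its images under shears
  comparable without Jacobians.
\<close>

definition simplicial_integral ::
    "'i set \<Rightarrow> ('i \<Rightarrow> 'v::euclidean_space) \<Rightarrow> ('v \<Rightarrow> ennreal) \<Rightarrow> ennreal" where
  "simplicial_integral I v \<phi> =
     (\<integral>\<^sup>+t. \<phi> (\<Sum>i\<in>I. t i *\<^sub>R v i) * indicator {t. \<forall>i\<in>I. 0 \<le> t i} t \<partial>Pi\<^sub>M I (\<lambda>_. lborel))"

lemma borel_measurable_linear:
  fixes f :: "'a::euclidean_space \<Rightarrow> 'b::euclidean_space"
  shows "linear f \<Longrightarrow> f \<in> borel_measurable borel"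
  by (intro borel_measurable_continuous_onI linear_continuous_on) (simp add: linear_conv_bounded_linear)

interpretation lborels: product_sigma_finite "\<lambda>_. lborel :: real measure"
  by standard

lemma orthant_indicator_measurable [measurable]:
  assumes "finite I"
  shows "(indicator {t. \<forall>i\<in>I. 0 \<le> t i} :: ('i \<Rightarrow> real) \<Rightarrow> ennreal)
           \<in> borel_measurable (Pi\<^sub>M I (\<lambda>_. lborel))"
proof -
  have eq: "indicator {t. \<forall>i\<in>I. 0 \<le> t i} = (\<lambda>t::'i \<Rightarrow> real. (\<Prod>i\<in>I. indicator {0..} (t i)) :: ennreal)"
    using assms by (auto simp: fun_eq_iff indicator_def prod_zero)
  show ?thesis
    unfolding eq using assms by measurable
qed

lemma simplicial_integral_cong:
  assumes "\<And>i. i \<in> I \<Longrightarrow> v i = w i"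
    and "\<And>t. (\<And>i. i \<in> I \<Longrightarrow> 0 \<le> t i) \<Longrightarrow> \<phi> (\<Sum>i\<in>I. t i *\<^sub>R w i) = \<psi> (\<Sum>i\<in>I. t i *\<^sub>R w i)"
  shows "simplicial_integral I v \<phi> = simplicial_integral I w \<psi>"
  unfolding simplicial_integral_def using assms
  by (intro nn_integral_cong) (auto simp: indicator_def cong: sum.cong)

lemma simplicial_integral_add:
  assumes "finite I" and [measurable]: "\<phi> \<in> borel_measurable borel" "\<psi> \<in> borel_measurable borel"
  shows "simplicial_integral I v (\<lambda>x. \<phi> x + \<psi> x) =
         simplicial_integral I v \<phi> + simplicial_integral I v \<psi>"
proof -
  note orthant_indicator_measurable[OF assms(1), measurable]
  show ?thesis
    unfolding simplicial_integral_def distrib_right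
    using assms(1) by (intro nn_integral_add) measurable
qed

lemma simplicial_integral_insert:
  fixes v :: "'i \<Rightarrow> 'v::euclidean_space"
  assumes I: "finite I" "i \<notin> I" and [measurable]: "\<phi> \<in> borel_measurable borel"
  shows "simplicial_integral (insert i I) v \<phi> =
         simplicial_integral I v (\<lambda>x. \<integral>\<^sup>+a. \<phi> (x + a *\<^sub>R v i) * indicator {0..} a \<partial>lborel)"
proof -
  note orthant_indicator_measurable[OF finite.insertI[OF I(1)], measurable]
  let ?O = "\<lambda>I. {t. \<forall>i\<in>I. 0 \<le> t i}"
  have "simplicial_integral (insert i I) v \<phi> =
      (\<integral>\<^sup>+t. (\<integral>\<^sup>+a. \<phi> (\<Sum>k\<in>insert i I. (t(i := a)) k *\<^sub>R v k) * indicator (?O (insert i I)) (t(i := a))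
        \<partial>lborel) \<partial>Pi\<^sub>M I (\<lambda>_. lborel))"
    unfolding simplicial_integral_def
    using I by (intro lborels.product_nn_integral_insert) measurable
  also have "\<dots> = (\<integral>\<^sup>+t. (\<integral>\<^sup>+a. (\<phi> ((\<Sum>k\<in>I. t k *\<^sub>R v k) + a *\<^sub>R v i) * indicator {0..} a)
        * indicator (?O I) t \<partial>lborel) \<partial>Pi\<^sub>M I (\<lambda>_. lborel))"
  proof (intro nn_integral_cong)
    fix t :: "'i \<Rightarrow> real" and a :: real
    have "(\<Sum>k\<in>insert i I. (t(i := a)) k *\<^sub>R v k) = (\<Sum>k\<in>I. t k *\<^sub>R v k) + a *\<^sub>R v i"
      using I by (subst sum.insert) (auto intro!: sum.cong simp: add.commute)
    moreover have "indicator (?O (insert i I)) (t(i := a)) =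
        (indicator {0..} a * indicator (?O I) t :: ennreal)"
      using I by (auto simp: indicator_def split: if_splits)
    ultimately show "\<phi> (\<Sum>k\<in>insert i I. (t(i := a)) k *\<^sub>R v k) * indicator (?O (insert i I)) (t(i := a)) =
        \<phi> ((\<Sum>k\<in>I. t k *\<^sub>R v k) + a *\<^sub>R v i) * indicator {0..} a * indicator (?O I) t"
      by (simp add: mult.assoc)
  qed
  also have "\<dots> = simplicial_integral I v (\<lambda>x. \<integral>\<^sup>+a. \<phi> (x + a *\<^sub>R v i) * indicator {0..} a \<partial>lborel)"
    unfolding simplicial_integral_def by (intro nn_integral_cong nn_integral_multc) measurable
  finally show ?thesis .
qed

lemma nn_integral_half_line_shift:
  fixes f :: "real \<Rightarrow> ennreal"
  assumes [measurable]: "f \<in> borel_measurable borel"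
  shows "(\<integral>\<^sup>+a. f a * indicator {0..} (a - c) \<partial>lborel) = (\<integral>\<^sup>+a. f (a + c) * indicator {0..} a \<partial>lborel)"
  by (subst nn_integral_real_affine[where t = c and c = 1])
     (auto intro!: nn_integral_cong simp: indicator_def add.commute)

text \<open>
  The ray \<open>a = \<kappa> b\<close> cuts the quadrant into two pieces; each is moved back onto the whole quadrant
  by a translation of one variable while the other one is fixed.
\<close>

lemma nn_integral_quadrant_split:
  fixes f :: "real \<Rightarrow> real \<Rightarrow> ennreal"
  assumes f[measurable]: "(\<lambda>(a, b). f a b) \<in> borel_measurable (borel \<Otimes>\<^sub>M borel)" and \<kappa>: "0 < \<kappa>"
  shows "(\<integral>\<^sup>+b. (\<integral>\<^sup>+a. f a b * indicator {0..} a \<partial>lborel) * indicator {0..} b \<partial>lborel) =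
         (\<integral>\<^sup>+b. (\<integral>\<^sup>+a. f (a + \<kappa> * b) b * indicator {0..} a \<partial>lborel) * indicator {0..} b \<partial>lborel) +
         (\<integral>\<^sup>+b. (\<integral>\<^sup>+a. f a (b + a / \<kappa>) * indicator {0..} a \<partial>lborel) * indicator {0..} b \<partial>lborel)"
proof -
  let ?I = "\<lambda>x. indicator {0..} x :: ennreal"
  have "(\<integral>\<^sup>+b. (\<integral>\<^sup>+a. f a b * ?I a \<partial>lborel) * ?I b \<partial>lborel) =
      (\<integral>\<^sup>+b. ((\<integral>\<^sup>+a. f a b * indicator {0..} (a - \<kappa> * b) \<partial>lborel) +
             (\<integral>\<^sup>+a. f a b * ?I a * indicator {0<..} (b - a / \<kappa>) \<partial>lborel)) * ?I b \<partial>lborel)"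
  proof (rule nn_integral_cong)
    fix b :: real
    show "(\<integral>\<^sup>+a. f a b * ?I a \<partial>lborel) * ?I b = ((\<integral>\<^sup>+a. f a b * indicator {0..} (a - \<kappa> * b) \<partial>lborel) +
             (\<integral>\<^sup>+a. f a b * ?I a * indicator {0<..} (b - a / \<kappa>) \<partial>lborel)) * ?I b"
    proof (cases "0 \<le> b")
      case True
      have *: "f a b * ?I a = f a b * indicator {0..} (a - \<kappa> * b) + f a b * ?I a * indicator {0<..} (b - a / \<kappa>)" for a
      proof -
        have "0 \<le> \<kappa> * b" "a / \<kappa> < b \<longleftrightarrow> \<not> \<kappa> * b \<le> a"
          using True \<kappa> by (auto simp: field_simps)
        then show ?thesis
          by (auto simp: indicator_def)
      qed
      show ?thesis
        by (subst *, subst nn_integral_add) auto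
    qed simp
  qed
  also have "\<dots> = (\<integral>\<^sup>+b. (\<integral>\<^sup>+a. f a b * indicator {0..} (a - \<kappa> * b) \<partial>lborel) * ?I b \<partial>lborel) +
      (\<integral>\<^sup>+b. (\<integral>\<^sup>+a. f a b * ?I a * indicator {0<..} (b - a / \<kappa>) \<partial>lborel) * ?I b \<partial>lborel)"
    unfolding distrib_right
    by (intro nn_integral_add) measurable
  also have "(\<integral>\<^sup>+b. (\<integral>\<^sup>+a. f a b * indicator {0..} (a - \<kappa> * b) \<partial>lborel) * ?I b \<partial>lborel) =
      (\<integral>\<^sup>+b. (\<integral>\<^sup>+a. f (a + \<kappa> * b) b * ?I a \<partial>lborel) * ?I b \<partial>lborel)"
    by (subst nn_integral_half_line_shift) auto
  also have "(\<integral>\<^sup>+b. (\<integral>\<^sup>+a. f a b * ?I a * indicator {0<..} (b - a / \<kappa>) \<partial>lborel) * ?I b \<partial>lborel) =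
      (\<integral>\<^sup>+b. (\<integral>\<^sup>+a. f a b * ?I a * indicator {0<..} (b - a / \<kappa>) * ?I b \<partial>lborel) \<partial>lborel)"
    by (intro nn_integral_cong nn_integral_multc[symmetric]) measurable
  also have "\<dots> = (\<integral>\<^sup>+a. (\<integral>\<^sup>+b. f a b * ?I a * indicator {0<..} (b - a / \<kappa>) * ?I b \<partial>lborel) \<partial>lborel)"
    by (intro lborel_pair.Fubini') measurable
  also have "\<dots> = (\<integral>\<^sup>+a. (\<integral>\<^sup>+b. (f a b * indicator {0..} (b - a / \<kappa>)) * ?I a \<partial>lborel) \<partial>lborel)"
  proof (rule nn_integral_cong, rule nn_integral_cong_AE)
    fix a :: real
    show "AE b in lborel. f a b * ?I a * indicator {0<..} (b - a / \<kappa>) * ?I b = f a b * indicator {0..} (b - a / \<kappa>) * ?I a"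
      using AE_lborel_singleton[of "a / \<kappa>"]
    proof eventually_elim
      case (elim b)
      have "0 \<le> a \<Longrightarrow> 0 \<le> a / \<kappa>"
        using \<kappa> by simp
      then show ?case
        using elim by (auto simp: indicator_def)
    qed
  qed
  also have "\<dots> = (\<integral>\<^sup>+a. (\<integral>\<^sup>+b. f a (b + a / \<kappa>) * ?I b \<partial>lborel) * ?I a \<partial>lborel)"
    by (intro nn_integral_cong, subst nn_integral_multc, measurable, subst nn_integral_half_line_shift)
       auto
  also have "\<dots> = (\<integral>\<^sup>+a. (\<integral>\<^sup>+b. f a (b + a / \<kappa>) * ?I b * ?I a \<partial>lborel) \<partial>lborel)"
    by (intro nn_integral_cong nn_integral_multc[symmetric]) measurable
  also have "\<dots> = (\<integral>\<^sup>+b. (\<integral>\<^sup>+a. f a (b + a / \<kappa>) * ?I b * ?I a \<partial>lborel) \<partial>lborel)"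
    by (intro lborel_pair.Fubini'[symmetric]) measurable
  also have "\<dots> = (\<integral>\<^sup>+b. (\<integral>\<^sup>+a. f a (b + a / \<kappa>) * ?I a * ?I b \<partial>lborel) \<partial>lborel)"
    by (simp add: mult_ac)
  also have "\<dots> = (\<integral>\<^sup>+b. (\<integral>\<^sup>+a. f a (b + a / \<kappa>) * ?I a \<partial>lborel) * ?I b \<partial>lborel)"
    by (intro nn_integral_cong nn_integral_multc) measurable
  finally show ?thesis .
qed

text \<open>
  The elementary step of every dissection: the quadrant of the coefficients \<open>t i\<close> and \<open>t j\<close> is cut along
  the ray \<open>t i = \<kappa> * t j\<close>, which becomes the generator shared by the two pieces.
\<close>

lemma simplicial_integral_split:
  fixes v :: "'i \<Rightarrow> 'v::euclidean_space"
  assumes I: "finite I" "i \<in> I" "j \<in> I" "i \<noteq> j" and \<kappa>: "0 < \<kappa>"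
    and \<phi>[measurable]: "\<phi> \<in> borel_measurable borel"
  shows "simplicial_integral I v \<phi> =
         simplicial_integral I (v(j := v j + \<kappa> *\<^sub>R v i)) \<phi> +
         simplicial_integral I (v(i := v i + (1 / \<kappa>) *\<^sub>R v j)) \<phi>"
proof -
  define J where "J = I - {i, j}"
  have J: "finite J" "i \<notin> insert j J" "j \<notin> J" "I = insert i (insert j J)"
    using I by (auto simp: J_def)
  have two: "simplicial_integral I u \<phi> = simplicial_integral J v
      (\<lambda>x. \<integral>\<^sup>+b. (\<integral>\<^sup>+a. \<phi> (x + b *\<^sub>R u j + a *\<^sub>R u i) * indicator {0..} a \<partial>lborel) * indicator {0..} b \<partial>lborel)"
    if "\<And>k. k \<in> J \<Longrightarrow> u k = v k" for u
  proof -
    have "simplicial_integral I u \<phi> = simplicial_integral J u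
      (\<lambda>x. \<integral>\<^sup>+b. (\<integral>\<^sup>+a. \<phi> (x + b *\<^sub>R u j + a *\<^sub>R u i) * indicator {0..} a \<partial>lborel) * indicator {0..} b \<partial>lborel)"
      unfolding J(4) using J(1-3) by (simp add: simplicial_integral_insert)
    then show ?thesis
      using that by (simp cong: simplicial_integral_cong)
  qed
  have "simplicial_integral I v \<phi> = simplicial_integral J v
      (\<lambda>x. (\<integral>\<^sup>+b. (\<integral>\<^sup>+a. \<phi> (x + b *\<^sub>R (v j + \<kappa> *\<^sub>R v i) + a *\<^sub>R v i) * indicator {0..} a \<partial>lborel) * indicator {0..} b \<partial>lborel)
        + (\<integral>\<^sup>+b. (\<integral>\<^sup>+a. \<phi> (x + b *\<^sub>R v j + a *\<^sub>R (v i + (1 / \<kappa>) *\<^sub>R v j)) * indicator {0..} a \<partial>lborel) * indicator {0..} b \<partial>lborel))"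
    unfolding two[OF refl]
  proof (rule simplicial_integral_cong)
    fix x
    show "(\<integral>\<^sup>+b. (\<integral>\<^sup>+a. \<phi> (x + b *\<^sub>R v j + a *\<^sub>R v i) * indicator {0..} a \<partial>lborel) * indicator {0..} b \<partial>lborel)
      = (\<integral>\<^sup>+b. (\<integral>\<^sup>+a. \<phi> (x + b *\<^sub>R (v j + \<kappa> *\<^sub>R v i) + a *\<^sub>R v i) * indicator {0..} a \<partial>lborel) * indicator {0..} b \<partial>lborel)
        + (\<integral>\<^sup>+b. (\<integral>\<^sup>+a. \<phi> (x + b *\<^sub>R v j + a *\<^sub>R (v i + (1 / \<kappa>) *\<^sub>R v j)) * indicator {0..} a \<partial>lborel) * indicator {0..} b \<partial>lborel)"
      using nn_integral_quadrant_split[of "\<lambda>a b. \<phi> (x + b *\<^sub>R v j + a *\<^sub>R v i)" \<kappa>] \<kappa>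
      by (simp add: algebra_simps)
  qed auto
  also have "\<dots> = simplicial_integral I (v(j := v j + \<kappa> *\<^sub>R v i)) \<phi> +
         simplicial_integral I (v(i := v i + (1 / \<kappa>) *\<^sub>R v j)) \<phi>"
    using J(1) I(4) two[of "v(j := v j + \<kappa> *\<^sub>R v i)"] two[of "v(i := v i + (1 / \<kappa>) *\<^sub>R v j)"]
    by (subst simplicial_integral_add) (simp_all add: J_def)
  finally show ?thesis .
qed

text \<open>
  The coefficient at \<open>i\<close> vanishes only on a null set.  This discards the part of a cone that meets a
  half-space in a proper face.
\<close>

lemma simplicial_integral_null:
  fixes v :: "'i \<Rightarrow> 'v::euclidean_space"
  assumes I: "finite I" "i \<in> I" and [measurable]: "\<phi> \<in> borel_measurable borel"
    and zero: "\<And>t. (\<And>k. k \<in> I \<Longrightarrow> 0 \<le> t k) \<Longrightarrow> 0 < t i \<Longrightarrow> \<phi> (\<Sum>k\<in>I. t k *\<^sub>R v k) = 0"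
  shows "simplicial_integral I v \<phi> = 0"
proof -
  define J where "J = I - {i}"
  have J: "finite J" "i \<notin> J" "I = insert i J"
    using I by (auto simp: J_def)
  have "(\<integral>\<^sup>+a. \<phi> ((\<Sum>k\<in>J. t k *\<^sub>R v k) + a *\<^sub>R v i) * indicator {0..} a \<partial>lborel) = 0"
    if t: "\<And>k. k \<in> J \<Longrightarrow> 0 \<le> t k" for t
  proof -
    have "\<phi> ((\<Sum>k\<in>J. t k *\<^sub>R v k) + a *\<^sub>R v i) * indicator {0..} a = 0" if "a \<noteq> 0" for a
    proof (cases "0 \<le> a")
      case True
      have "(\<Sum>k\<in>I. (t(i := a)) k *\<^sub>R v k) = (\<Sum>k\<in>J. t k *\<^sub>R v k) + a *\<^sub>R v i"
        unfolding J(3) using J by (subst sum.insert) (auto intro!: sum.cong simp: add.commute)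
      moreover have "\<phi> (\<Sum>k\<in>I. (t(i := a)) k *\<^sub>R v k) = 0"
        using True that t J by (intro zero) auto
      ultimately show ?thesis by simp
    qed auto
    then have "AE a in lborel. \<phi> ((\<Sum>k\<in>J. t k *\<^sub>R v k) + a *\<^sub>R v i) * indicator {0..} a = 0"
      by (intro AE_mp[OF AE_lborel_singleton[of 0] AE_I2] impI)
    then have "(\<integral>\<^sup>+a. \<phi> ((\<Sum>k\<in>J. t k *\<^sub>R v k) + a *\<^sub>R v i) * indicator {0..} a \<partial>lborel) = (\<integral>\<^sup>+a. 0 \<partial>(lborel :: real measure))"
      by (rule nn_integral_cong_AE)
    then show ?thesis by simp
  qed
  then have "(\<lambda>t. (\<integral>\<^sup>+a. \<phi> ((\<Sum>k\<in>J. t k *\<^sub>R v k) + a *\<^sub>R v i) * indicator {0..} a \<partial>lborel) *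
      indicator {t. \<forall>i\<in>J. 0 \<le> t i} t) = (\<lambda>_. 0)"
    by (auto simp: fun_eq_iff indicator_def)
  then have "simplicial_integral J v (\<lambda>x. \<integral>\<^sup>+a. \<phi> (x + a *\<^sub>R v i) * indicator {0..} a \<partial>lborel) = 0"
    unfolding simplicial_integral_def by simp
  then show ?thesis
    unfolding J(3) using J by (simp add: simplicial_integral_insert)
qed

text \<open>
  A dissection, up to null sets, of the part of a simplicial cone that lies in \<open>S\<close>, expressed by its
  effect on integrals.
\<close>

definition dissects ::
    "'i set \<Rightarrow> ('i \<Rightarrow> 'v::euclidean_space) \<Rightarrow> 'v set \<Rightarrow> ('i \<Rightarrow> 'v) list \<Rightarrow> bool" where
  "dissects I v S W \<longleftrightarrow> (\<forall>\<phi>\<in>borel_measurable borel.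
     simplicial_integral I v (\<lambda>x. \<phi> x * indicator S x) = (\<Sum>w\<leftarrow>W. simplicial_integral I w \<phi>))"

lemma dissects_trivial:
  assumes "\<And>t. (\<And>i. i \<in> I \<Longrightarrow> 0 \<le> t i) \<Longrightarrow> (\<Sum>i\<in>I. t i *\<^sub>R v i) \<in> S"
  shows "dissects I v S [v]"
  unfolding dissects_def using assms by (auto intro!: simplicial_integral_cong)

lemma dissects_compose:
  assumes W: "dissects I v S W" and f: "\<And>w. w \<in> set W \<Longrightarrow> dissects I w T (f w)"
    and T[measurable]: "T \<in> sets borel"
  shows "dissects I v (S \<inter> T) (concat (map f W))"
  unfolding dissects_def
proof
  fix \<phi> :: "'b \<Rightarrow> ennreal" assume [measurable]: "\<phi> \<in> borel_measurable borel"
  have "simplicial_integral I v (\<lambda>x. \<phi> x * indicator (S \<inter> T) x) =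
      simplicial_integral I v (\<lambda>x. (\<phi> x * indicator T x) * indicator S x)"
    by (intro simplicial_integral_cong) (auto simp: indicator_def)
  also have "\<dots> = (\<Sum>w\<leftarrow>W. simplicial_integral I w (\<lambda>x. \<phi> x * indicator T x))"
    using W unfolding dissects_def by simp
  also have "\<dots> = (\<Sum>w\<leftarrow>W. \<Sum>u\<leftarrow>f w. simplicial_integral I u \<phi>)"
    using f unfolding dissects_def by (intro arg_cong[where f = sum_list] map_cong) auto
  also have "\<dots> = (\<Sum>u\<leftarrow>concat (map f W). simplicial_integral I u \<phi>)"
    by (induction W) auto
  finally show "simplicial_integral I v (\<lambda>x. \<phi> x * indicator (S \<inter> T) x) =
      (\<Sum>u\<leftarrow>concat (map f W). simplicial_integral I u \<phi>)" .
qed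

lemma polyhedral_cone_borel:
  fixes A :: "('v::euclidean_space \<Rightarrow> real) set"
  assumes "finite A" "\<And>c. c \<in> A \<Longrightarrow> linear c"
  shows "{x. \<forall>c\<in>A. 0 \<le> c x} \<in> sets borel"
proof -
  have "{x \<in> space borel. 0 \<le> c x} \<in> sets borel" if "c \<in> A" for c
    using borel_measurable_linear[OF assms(2)[OF that]] by measurable
  then have "{x \<in> space borel. \<forall>c\<in>A. 0 \<le> c x} \<in> sets borel"
    using assms(1) by (intro sets.sets_Collect_finite_All)
  then show ?thesis by simp
qed

text \<open>
  If \<open>c\<close> is positive on one generator and negative on another, the plane face that they span contains
  a ray on which \<open>c\<close> vanishes.  Cutting the cone along this ray produces two cones with fewer generators
  off the hyperplane.  In the end each piece lies on one side of it.  The set \<open>X\<close> records whatever property of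
  the generators is stable under positive combinations.
\<close>

lemma dissect_halfspace:
  fixes v :: "'i \<Rightarrow> 'v::euclidean_space"
  assumes I: "finite I" and c: "linear c"
    and X: "\<And>x y \<kappa>. x \<in> X \<Longrightarrow> y \<in> X \<Longrightarrow> 0 < \<kappa> \<Longrightarrow> x + \<kappa> *\<^sub>R y \<in> X"
    and v: "v \<in> I \<rightarrow> X"
  shows "\<exists>W. (\<forall>w\<in>set W. w \<in> I \<rightarrow> X \<inter> {x. 0 \<le> (c x :: real)}) \<and> dissects I v {x. 0 \<le> c x} W"
  using v
proof (induction "card {i\<in>I. c (v i) \<noteq> 0}" arbitrary: v rule: less_induct)
  case less
  note borel_measurable_linear[OF c, measurable]
  have c_sum: "c (\<Sum>k\<in>I. t k *\<^sub>R v k) = (\<Sum>k\<in>I. t k * c (v k))" for t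
    using c by (simp add: linear_sum linear_cmul)
  consider "\<forall>i\<in>I. 0 \<le> c (v i)"
    | i j where "i \<in> I" "j \<in> I" "0 < c (v i)" "c (v j) < 0"
    | j where "j \<in> I" "c (v j) < 0" "\<forall>i\<in>I. c (v i) \<le> 0"
    by (meson not_le)
  then show ?case
  proof cases
    case 1
    have "dissects I v {x. 0 \<le> c x} [v]"
      using 1 by (intro dissects_trivial) (auto simp: c_sum intro!: sum_nonneg)
    then show ?thesis
      using 1 less.prems by (intro exI[of _ "[v]"]) auto
  next
    case (2 i j)
    \<comment> \<open>The slope for which \<open>c\<close> vanishes on the new generators.\<close>
    define \<kappa> where "\<kappa> = - c (v j) / c (v i)"
    have \<kappa>: "0 < \<kappa>"
      using 2 by (simp add: \<kappa>_def divide_neg_pos)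
    have "i \<noteq> j" using 2 by auto
    define v1 where "v1 = v(j := v j + \<kappa> *\<^sub>R v i)"
    define v2 where "v2 = v(i := v i + (1 / \<kappa>) *\<^sub>R v j)"
    have c1: "c (v j + \<kappa> *\<^sub>R v i) = 0" and c2: "c (v i + (1 / \<kappa>) *\<^sub>R v j) = 0"
      using 2 by (simp_all add: linear_add[OF c] linear_diff[OF c] linear_cmul[OF c] \<kappa>_def)
    have "{k\<in>I. c (v1 k) \<noteq> 0} = {k\<in>I. c (v k) \<noteq> 0} - {j}"
      using c1 by (auto simp: v1_def)
    then have "card {k\<in>I. c (v1 k) \<noteq> 0} < card {k\<in>I. c (v k) \<noteq> 0}"
      using I 2 by (simp only:) (rule card_Diff1_less, auto)
    moreover have "v1 \<in> I \<rightarrow> X"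
      using less.prems 2 \<kappa> by (auto simp: v1_def Pi_iff intro!: X)
    ultimately obtain W1 where W1: "\<forall>w\<in>set W1. w \<in> I \<rightarrow> X \<inter> {x. 0 \<le> c x}"
      "dissects I v1 {x. 0 \<le> c x} W1"
      using less.hyps by blast
    have "{k\<in>I. c (v2 k) \<noteq> 0} = {k\<in>I. c (v k) \<noteq> 0} - {i}"
      using c2 by (auto simp: v2_def)
    then have "card {k\<in>I. c (v2 k) \<noteq> 0} < card {k\<in>I. c (v k) \<noteq> 0}"
      using I 2 by (simp only:) (rule card_Diff1_less, auto)
    moreover have "v2 \<in> I \<rightarrow> X"
      using less.prems X[of "v i" "v j" "1 / \<kappa>"] 2 \<kappa> by (auto simp: v2_def Pi_iff)
    ultimately obtain W2 where W2: "\<forall>w\<in>set W2. w \<in> I \<rightarrow> X \<inter> {x. 0 \<le> c x}"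
      "dissects I v2 {x. 0 \<le> c x} W2"
      using less.hyps by blast
    have "dissects I v {x. 0 \<le> c x} (W1 @ W2)"
      unfolding dissects_def
    proof
      fix \<phi> :: "'v \<Rightarrow> ennreal" assume [measurable]: "\<phi> \<in> borel_measurable borel"
      show "simplicial_integral I v (\<lambda>x. \<phi> x * indicator {x. 0 \<le> c x} x) =
          (\<Sum>w\<leftarrow>W1 @ W2. simplicial_integral I w \<phi>)"
        using simplicial_integral_split[OF I 2(1,2) \<open>i \<noteq> j\<close> \<kappa>, of "\<lambda>x. \<phi> x * indicator {x. 0 \<le> c x} x" v]
          W1(2) W2(2) by (simp add: v1_def v2_def dissects_def)
    qed
    then show ?thesis
      using W1(1) W2(1) by (intro exI[of _ "W1 @ W2"]) auto
  next
    case (3 j)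
    have "simplicial_integral I v (\<lambda>x. \<phi> x * indicator {x. 0 \<le> c x} x) = 0"
      if [measurable]: "\<phi> \<in> borel_measurable borel" for \<phi>
    proof (rule simplicial_integral_null[OF I 3(1)])
      fix t :: "'i \<Rightarrow> real" assume t: "\<And>k. k \<in> I \<Longrightarrow> 0 \<le> t k" "0 < t j"
      have "0 < (\<Sum>k\<in>I. - (t k * c (v k)))"
        using I 3 t by (intro sum_pos2[of _ j]) (auto simp: mult_pos_neg mult_nonneg_nonpos)
      then show "\<phi> (\<Sum>k\<in>I. t k *\<^sub>R v k) * indicator {x. 0 \<le> c x} (\<Sum>k\<in>I. t k *\<^sub>R v k) = 0"
        by (simp add: c_sum sum_negf)
    qed simp
    then show ?thesis
      by (intro exI[of _ "[]"]) (simp add: dissects_def)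
  qed
qed

lemma dissect_polyhedral_cone:
  fixes v :: "'i \<Rightarrow> 'v::euclidean_space"
  assumes I: "finite I" and A: "finite A" "\<And>c. c \<in> A \<Longrightarrow> linear c"
    and X: "\<And>x y \<kappa>. x \<in> X \<Longrightarrow> y \<in> X \<Longrightarrow> 0 < \<kappa> \<Longrightarrow> x + \<kappa> *\<^sub>R y \<in> X"
    and v: "v \<in> I \<rightarrow> X"
  shows "\<exists>W. (\<forall>w\<in>set W. w \<in> I \<rightarrow> X \<inter> {x. \<forall>c\<in>A. 0 \<le> (c x :: real)}) \<and>
             dissects I v {x. \<forall>c\<in>A. 0 \<le> c x} W"
  using A X v
proof (induction A arbitrary: X v rule: finite_induct)
  case empty
  then show ?case by (intro exI[of _ "[v]"]) (auto intro: dissects_trivial)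
next
  case (insert c A)
  let ?H = "{x. 0 \<le> c x}" and ?K = "{x. \<forall>c\<in>A. 0 \<le> c x}"
  have c: "linear c" and lin: "\<And>a. a \<in> A \<Longrightarrow> linear a"
    using insert.prems(1) by auto
  obtain W where W: "\<forall>w\<in>set W. w \<in> I \<rightarrow> X \<inter> ?H" "dissects I v ?H W"
    using dissect_halfspace[OF I c insert.prems(2,3)] by blast
  have XH: "x + \<kappa> *\<^sub>R y \<in> X \<inter> ?H" if "x \<in> X \<inter> ?H" "y \<in> X \<inter> ?H" "0 < \<kappa>" for x y \<kappa>
    using that insert.prems(2) c by (auto simp: linear_add linear_cmul)
  have "\<forall>w\<in>set W. \<exists>W'. (\<forall>u\<in>set W'. u \<in> I \<rightarrow> X \<inter> ?H \<inter> ?K) \<and> dissects I w ?K W'"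
    using W(1) by (intro ballI insert.IH XH lin) auto
  from bchoice[OF this] obtain f where
    f: "\<forall>w\<in>set W. (\<forall>u\<in>set (f w). u \<in> I \<rightarrow> X \<inter> ?H \<inter> ?K) \<and> dissects I w ?K (f w)"
    by (elim exE)
  have "dissects I v (?H \<inter> ?K) (concat (map f W))"
    using f W(2) insert.hyps(1) lin by (intro dissects_compose polyhedral_cone_borel) auto
  moreover have "?H \<inter> ?K = {x. \<forall>c\<in>insert c A. 0 \<le> c x}"
    by auto
  ultimately show ?case
    using f by (intro exI[of _ "concat (map f W)"]) fastforce
qed

lemma nn_integral_exp_half_line:
  assumes "0 < (a::real)"
  shows "(\<integral>\<^sup>+t. ennreal (exp (- (t * a))) * indicator {0..} t \<partial>lborel) = ennreal (1 / a)"
proof -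
  have "(\<integral>\<^sup>+t. ennreal (exp (- (t * a))) * indicator {0..} t \<partial>lborel) =
      ennreal (0 - (- exp (- (0 * a)) / a))"
    using assms
    by (intro nn_integral_FTC_atLeast[where F = "\<lambda>t. - exp (- (t * a)) / a"])
       (auto intro!: derivative_eq_intros, real_asymp)
  then show ?thesis by simp
qed

text \<open>
  The integrand is a product of one-variable exponentials of the coefficients.
\<close>

lemma simplicial_integral_exp:
  fixes v :: "'i \<Rightarrow> 'v::euclidean_space"
  assumes I: "finite I" and pos: "\<And>i. i \<in> I \<Longrightarrow> 0 < v i \<bullet> y"
  shows "simplicial_integral I v (\<lambda>x. ennreal (exp (- (x \<bullet> y)))) = ennreal (\<Prod>i\<in>I. 1 / (v i \<bullet> y))"
proof -
  have "simplicial_integral I v (\<lambda>x. ennreal (exp (- (x \<bullet> y)))) =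
      (\<integral>\<^sup>+t. (\<Prod>i\<in>I. ennreal (exp (- (t i * (v i \<bullet> y)))) * indicator {0..} (t i)) \<partial>Pi\<^sub>M I (\<lambda>_. lborel))"
    unfolding simplicial_integral_def
  proof (intro nn_integral_cong)
    fix t :: "'i \<Rightarrow> real"
    have "ennreal (exp (- ((\<Sum>i\<in>I. t i *\<^sub>R v i) \<bullet> y))) = (\<Prod>i\<in>I. ennreal (exp (- (t i * (v i \<bullet> y)))))"
      using I by (simp add: inner_sum_left sum_negf[symmetric] exp_sum prod_ennreal)
    moreover have "indicator {t. \<forall>i\<in>I. 0 \<le> t i} t = (\<Prod>i\<in>I. indicator {0..} (t i) :: ennreal)"
      using I by (auto simp: indicator_def prod_zero)
    ultimately show "ennreal (exp (- ((\<Sum>i\<in>I. t i *\<^sub>R v i) \<bullet> y))) * indicator {t. \<forall>i\<in>I. 0 \<le> t i} t =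
        (\<Prod>i\<in>I. ennreal (exp (- (t i * (v i \<bullet> y)))) * indicator {0..} (t i))"
      by (simp add: prod.distrib)
  qed
  also have "\<dots> = (\<Prod>i\<in>I. \<integral>\<^sup>+t. ennreal (exp (- (t * (v i \<bullet> y)))) * indicator {0..} t \<partial>lborel)"
    using I by (intro lborels.product_nn_integral_prod) auto
  also have "\<dots> = (\<Prod>i\<in>I. ennreal (1 / (v i \<bullet> y)))"
    using pos by (intro prod.cong refl nn_integral_exp_half_line) auto
  also have "\<dots> = ennreal (\<Prod>i\<in>I. 1 / (v i \<bullet> y))"
    using pos by (intro prod_ennreal) (auto intro: less_imp_le)
  finally show ?thesis .
qed

section \<open>Rational functions\<close>

lift_definition linear_poly :: "real ^ 'n::finite \<Rightarrow> 'n mpoly" is "\<lambda>w y. w \<bullet> y"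
  by (intro real_polynomial_function.intros(1) bounded_linear_inner_right)

definition inv_linear :: "real ^ 'n::finite \<Rightarrow> 'n ratfun" where
  "inv_linear w = Fract 1 (linear_poly w)"

definition zero_coord :: "'n::finite \<Rightarrow> real ^ 'n \<Rightarrow> real ^ 'n" where
  "zero_coord i w = (\<chi> j. if j = i then 0 else w $ j)"

lemma linear_poly_nonzero: "w \<noteq> 0 \<Longrightarrow> linear_poly w \<noteq> 0"
  by (metis inner_eq_zero_iff linear_poly.rep_eq zero_mpoly.rep_eq)

lemma mvar_eq_linear_poly: "mvar i = linear_poly (axis i 1)"
  by transfer (simp add: fun_eq_iff inner_axis')

lemma restrict_linear_poly: "restrict_poly i (linear_poly w) = linear_poly (zero_coord i w)"
  unfolding zero_coord_def
  by transfer (auto simp: inner_vec_def fun_eq_iff intro!: sum.cong)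

lemma rvar_nonzero: "rvar i \<noteq> 0"
  using linear_poly_nonzero[of "axis i 1"]
  by (simp add: rvar_def mvar_eq_linear_poly Zero_fract_def eq_fract axis_eq_0_iff)

lemma inv_linear_axis: "inv_linear (axis i 1) = 1 / rvar i"
  by (simp add: inv_linear_def rvar_def mvar_eq_linear_poly One_fract_def)

lemma restrict_poly_1 [simp]: "restrict_poly i 1 = 1"
  by transfer simp

lemma restrict_poly_add: "restrict_poly i (P + Q) = restrict_poly i P + restrict_poly i Q"
  by transfer simp

lemma represents_0: "represents 0 (\<lambda>_. 0) D"
  unfolding represents_def by (intro exI[of _ 0] exI[of _ 1]) (simp add: Zero_fract_def zero_mpoly.rep_eq)

lemma represents_1: "represents 1 (\<lambda>_. 1) D"
  unfolding represents_def by (intro exI[of _ 1]) (simp add: One_fract_def)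

lemma represents_add:
  assumes "represents R f D" "represents S g D"
  shows "represents (R + S) (\<lambda>y. f y + g y) D"
proof -
  obtain P Q where 1: "Q \<noteq> 0" "R = Fract P Q" "\<forall>y\<in>D. eval Q y * f y = eval P y"
    using assms(1) unfolding represents_def by blast
  obtain P' Q' where 2: "Q' \<noteq> 0" "S = Fract P' Q'" "\<forall>y\<in>D. eval Q' y * g y = eval P' y"
    using assms(2) unfolding represents_def by blast
  show ?thesis
    unfolding represents_def
    using 1 2 by (intro exI[of _ "P * Q' + P' * Q"] exI[of _ "Q * Q'"])
      (simp add: times_mpoly.rep_eq plus_mpoly.rep_eq algebra_simps flip: 1(3) 2(3))
qed

lemma represents_mult:
  assumes "represents R f D" "represents S g D"
  shows "represents (R * S) (\<lambda>y. f y * g y) D"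
proof -
  obtain P Q where 1: "Q \<noteq> 0" "R = Fract P Q" "\<forall>y\<in>D. eval Q y * f y = eval P y"
    using assms(1) unfolding represents_def by blast
  obtain P' Q' where 2: "Q' \<noteq> 0" "S = Fract P' Q'" "\<forall>y\<in>D. eval Q' y * g y = eval P' y"
    using assms(2) unfolding represents_def by blast
  show ?thesis
    unfolding represents_def
    using 1 2 by (intro exI[of _ "P * P'"] exI[of _ "Q * Q'"])
      (simp add: times_mpoly.rep_eq algebra_simps flip: 1(3) 2(3))
qed

lemma represents_inv_linear:
  assumes "w \<noteq> 0" "\<And>y. y \<in> D \<Longrightarrow> w \<bullet> y \<noteq> 0"
  shows "represents (inv_linear w) (\<lambda>y. 1 / (w \<bullet> y)) D"
  unfolding represents_def inv_linear_def
  using assms by (intro exI[of _ 1] exI[of _ "linear_poly w"])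
    (simp add: linear_poly_nonzero linear_poly.rep_eq one_mpoly.rep_eq)

lemma represents_prod:
  assumes "\<And>i. i \<in> I \<Longrightarrow> represents (R i) (f i) D"
  shows "represents (\<Prod>i\<in>I. R i) (\<lambda>y. \<Prod>i\<in>I. f i y) D"
  using assms
  by (induction I rule: infinite_finite_induct) (auto simp: represents_1 intro: represents_mult)

lemma represents_sum_list:
  assumes "\<And>w. w \<in> set W \<Longrightarrow> represents (R w) (f w) D"
  shows "represents (\<Sum>w\<leftarrow>W. R w) (\<lambda>y. \<Sum>w\<leftarrow>W. f w y) D"
  using assms by (induction W) (auto simp: represents_0 intro: represents_add)

lemma represents_cong:
  "represents R f D \<Longrightarrow> (\<And>y. y \<in> D \<Longrightarrow> f y = g y) \<Longrightarrow> represents R g D"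
  unfolding represents_def by (metis)

text \<open>
  The restriction of a rational function to \<open>y\<^sub>i = 0\<close>, separated from the factor \<open>y\<^sub>i\<close> in
  \<^const>\<open>has_residue\<close> because, unlike residues, restrictions are compatible with products.
\<close>

definition restricts_to :: "'n::finite \<Rightarrow> 'n ratfun \<Rightarrow> 'n ratfun \<Rightarrow> bool" where
  "restricts_to i R S \<longleftrightarrow>
     (\<exists>P Q. restrict_poly i Q \<noteq> 0 \<and> R = Fract P Q \<and>
            S = Fract (restrict_poly i P) (restrict_poly i Q))"

lemma has_residue_iff_restricts_to: "has_residue i R S \<longleftrightarrow> restricts_to i (rvar i * R) S"
  by (simp add: has_residue_def restricts_to_def)

lemma restricts_to_0: "restricts_to i 0 0"
  unfolding restricts_to_def by (intro exI[of _ 0] exI[of _ 1]) (simp add: Zero_fract_def)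

lemma restricts_to_1: "restricts_to i 1 1"
  unfolding restricts_to_def by (intro exI[of _ 1]) (simp add: One_fract_def)

lemma restricts_to_rvar: "restricts_to i (rvar i) 0"
proof -
  have "restrict_poly i (mvar i) = 0"
    by transfer simp
  then show ?thesis
    unfolding restricts_to_def rvar_def
    by (intro exI[of _ "mvar i"] exI[of _ 1]) (simp add: Zero_fract_def)
qed

lemma restricts_to_inv_linear:
  assumes "zero_coord i w \<noteq> 0"
  shows "restricts_to i (inv_linear w) (inv_linear (zero_coord i w))"
  unfolding restricts_to_def inv_linear_def
  using assms by (intro exI[of _ 1] exI[of _ "linear_poly w"])
    (simp add: linear_poly_nonzero restrict_linear_poly)

lemma restricts_to_add:
  assumes "restricts_to i R S" "restricts_to i R' S'"
  shows "restricts_to i (R + R') (S + S')"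
proof -
  obtain P Q where 1: "restrict_poly i Q \<noteq> 0" "R = Fract P Q" "S = Fract (restrict_poly i P) (restrict_poly i Q)"
    using assms(1) unfolding restricts_to_def by blast
  obtain P' Q' where 2: "restrict_poly i Q' \<noteq> 0" "R' = Fract P' Q'" "S' = Fract (restrict_poly i P') (restrict_poly i Q')"
    using assms(2) unfolding restricts_to_def by blast
  have "Q \<noteq> 0" "Q' \<noteq> 0"
    using 1(1) 2(1) by auto
  then show ?thesis
    unfolding restricts_to_def
    using 1 2 by (intro exI[of _ "P * Q' + P' * Q"] exI[of _ "Q * Q'"])
      (simp add: restrict_poly_mult restrict_poly_add)
qed

lemma restricts_to_mult:
  assumes "restricts_to i R S" "restricts_to i R' S'"
  shows "restricts_to i (R * R') (S * S')"
proof -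
  obtain P Q where 1: "restrict_poly i Q \<noteq> 0" "R = Fract P Q" "S = Fract (restrict_poly i P) (restrict_poly i Q)"
    using assms(1) unfolding restricts_to_def by blast
  obtain P' Q' where 2: "restrict_poly i Q' \<noteq> 0" "R' = Fract P' Q'" "S' = Fract (restrict_poly i P') (restrict_poly i Q')"
    using assms(2) unfolding restricts_to_def by blast
  show ?thesis
    unfolding restricts_to_def
    using 1 2 by (intro exI[of _ "P * P'"] exI[of _ "Q * Q'"]) (simp add: restrict_poly_mult)
qed

lemma restricts_to_prod:
  assumes "\<And>k. k \<in> I \<Longrightarrow> restricts_to i (R k) (S k)"
  shows "restricts_to i (\<Prod>k\<in>I. R k) (\<Prod>k\<in>I. S k)"
  using assms
  by (induction I rule: infinite_finite_induct) (auto simp: restricts_to_1 intro: restricts_to_mult)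

lemma restricts_to_sum:
  assumes "\<And>k. k \<in> I \<Longrightarrow> restricts_to i (R k) (S k)"
  shows "restricts_to i (\<Sum>k\<in>I. R k) (\<Sum>k\<in>I. S k)"
  using assms
  by (induction I rule: infinite_finite_induct) (auto simp: restricts_to_0 intro: restricts_to_add)

lemma restricts_to_sum_list:
  assumes "\<And>w. w \<in> set W \<Longrightarrow> restricts_to i (R w) (S w)"
  shows "restricts_to i (\<Sum>w\<leftarrow>W. R w) (\<Sum>w\<leftarrow>W. S w)"
  using assms by (induction W) (auto simp: restricts_to_0 intro: restricts_to_add)

section \<open>Independence of the lattice basis\<close>

lemma measurable_vec_lambda [measurable]:
  "(\<lambda>t. \<chi> i::'n::finite. t i) \<in> borel_measurable (Pi\<^sub>M UNIV (\<lambda>_. lborel :: real measure))"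
proof -
  have "(\<lambda>t. \<chi> i::'n. t i) = (\<lambda>t. \<Sum>i\<in>UNIV. t i *\<^sub>R axis i (1::real))"
    by (auto simp: fun_eq_iff vec_eq_iff axis_def if_distrib cong: if_cong)
  then show ?thesis
    by simp
qed

text \<open>
  Makes Fubini available for any splitting of the coordinates.
\<close>

lemma nn_integral_lborel_vec:
  fixes \<phi> :: "real ^ 'n::finite \<Rightarrow> ennreal"
  assumes [measurable]: "\<phi> \<in> borel_measurable borel"
  shows "(\<integral>\<^sup>+x. \<phi> x \<partial>lborel) = (\<integral>\<^sup>+t. \<phi> (\<chi> i. t i) \<partial>Pi\<^sub>M UNIV (\<lambda>_. lborel))"
proof -
  have "(lborel :: (real ^ 'n) measure) = distr (Pi\<^sub>M UNIV (\<lambda>_. lborel)) borel (\<lambda>t. \<chi> i. t i)"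
  proof (rule lborel_eqI)
    fix l u :: "real ^ 'n"
    assume le: "\<And>b. b \<in> Basis \<Longrightarrow> l \<bullet> b \<le> u \<bullet> b"
    have le': "l $ i \<le> u $ i" for i
      using le[of "axis i 1"] by (auto simp: inner_axis)
    have "(\<lambda>t. \<chi> i::'n. t i) -` box l u \<inter> space (Pi\<^sub>M UNIV (\<lambda>_. lborel)) = Pi\<^sub>E UNIV (\<lambda>i. {l $ i<..<u $ i})"
      by (auto simp: mem_box_cart space_PiM PiE_UNIV_domain Pi_iff)
    then have "emeasure (distr (Pi\<^sub>M UNIV (\<lambda>_. lborel)) borel (\<lambda>t. \<chi> i::'n. t i)) (box l u) =
        (\<Prod>i\<in>UNIV. emeasure lborel {l $ i<..<u $ i})"
      by (simp add: emeasure_distr lborels.emeasure_PiM)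
    also have "\<dots> = (\<Prod>i\<in>UNIV. ennreal (u $ i - l $ i))"
      using le' by (intro prod.cong) simp_all
    also have "\<dots> = (\<Prod>b\<in>Basis. ennreal ((u - l) \<bullet> b))"
      by (simp add: Basis_vec_def cart_eq_inner_axis axis_eq_axis prod.UNION_disjoint inner_diff_left)
    also have "\<dots> = ennreal (\<Prod>b\<in>Basis. (u - l) \<bullet> b)"
      using le by (intro prod_ennreal) (auto simp: inner_diff_left)
    finally show "emeasure (distr (Pi\<^sub>M UNIV (\<lambda>_. lborel)) borel (\<lambda>t. \<chi> i::'n. t i)) (box l u) =
      (\<Prod>b\<in>Basis. (u - l) \<bullet> b)" .
  qed simp
  then have "(\<integral>\<^sup>+x. \<phi> x \<partial>lborel) =
      (\<integral>\<^sup>+x. \<phi> x \<partial>distr (Pi\<^sub>M UNIV (\<lambda>_. lborel)) borel (\<lambda>t. \<chi> i::'n. t i))"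
    by simp
  then show ?thesis
    by (simp add: nn_integral_distr)
qed

text \<open>
  Every linear map is a composition of coordinate scalings, transpositions, additions of one coordinate
  to another, and maps with a vanishing coordinate.  The last kind is singular, and the formula is
  elementary for the others.
\<close>

lemma nn_integral_linear_change:
  fixes f :: "real ^ 'n::finite \<Rightarrow> real ^ 'n"
  assumes "linear f"
  shows "det (matrix f) \<noteq> 0 \<longrightarrow> (\<forall>\<phi>\<in>borel_measurable borel.
           ennreal \<bar>det (matrix f)\<bar> * (\<integral>\<^sup>+x. \<phi> (f x) \<partial>lborel) = (\<integral>\<^sup>+x. \<phi> x \<partial>lborel))"
proof (rule induct_linear_elementary[OF assms])
  fix f g :: "real ^ 'n \<Rightarrow> real ^ 'n"
  assume lin: "linear f" "linear g"
    and f: "det (matrix f) \<noteq> 0 \<longrightarrow> (\<forall>\<phi>\<in>borel_measurable borel.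
           ennreal \<bar>det (matrix f)\<bar> * (\<integral>\<^sup>+x. \<phi> (f x) \<partial>lborel) = (\<integral>\<^sup>+x. \<phi> x \<partial>lborel))"
    and g: "det (matrix g) \<noteq> 0 \<longrightarrow> (\<forall>\<phi>\<in>borel_measurable borel.
           ennreal \<bar>det (matrix g)\<bar> * (\<integral>\<^sup>+x. \<phi> (g x) \<partial>lborel) = (\<integral>\<^sup>+x. \<phi> x \<partial>lborel))"
  note borel_measurable_linear[OF lin(1), measurable]
  have det: "det (matrix (f \<circ> g)) = det (matrix f) * det (matrix g)"
    using lin by (simp add: matrix_compose det_mul)
  show "det (matrix (f \<circ> g)) \<noteq> 0 \<longrightarrow> (\<forall>\<phi>\<in>borel_measurable borel.
           ennreal \<bar>det (matrix (f \<circ> g))\<bar> * (\<integral>\<^sup>+x. \<phi> ((f \<circ> g) x) \<partial>lborel) = (\<integral>\<^sup>+x. \<phi> x \<partial>lborel))"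
  proof (intro impI ballI)
    fix \<phi> :: "real ^ 'n \<Rightarrow> ennreal"
    assume nz: "det (matrix (f \<circ> g)) \<noteq> 0" and [measurable]: "\<phi> \<in> borel_measurable borel"
    have "ennreal \<bar>det (matrix g)\<bar> * (\<integral>\<^sup>+x. \<phi> (f (g x)) \<partial>lborel) = (\<integral>\<^sup>+x. \<phi> (f x) \<partial>lborel)"
      using g[rule_format, of "\<lambda>x. \<phi> (f x)"] nz by (simp add: det)
    moreover have "ennreal \<bar>det (matrix f)\<bar> * (\<integral>\<^sup>+x. \<phi> (f x) \<partial>lborel) = (\<integral>\<^sup>+x. \<phi> x \<partial>lborel)"
      using f nz by (simp add: det)
    ultimately show "ennreal \<bar>det (matrix (f \<circ> g))\<bar> * (\<integral>\<^sup>+x. \<phi> ((f \<circ> g) x) \<partial>lborel) = (\<integral>\<^sup>+x. \<phi> x \<partial>lborel)"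
      by (simp add: det abs_mult ennreal_mult mult.assoc)
  qed
next
  fix f :: "real ^ 'n \<Rightarrow> real ^ 'n" and i
  assume "linear f" and 0: "\<And>x. f x $ i = 0"
  then have "row i (matrix f) = 0"
    by (simp add: row_def matrix_def vec_eq_iff)
  then have "det (matrix f) = 0"
    by (rule det_zero_row)
  then show "det (matrix f) \<noteq> 0 \<longrightarrow> (\<forall>\<phi>\<in>borel_measurable borel.
           ennreal \<bar>det (matrix f)\<bar> * (\<integral>\<^sup>+x. \<phi> (f x) \<partial>lborel) = (\<integral>\<^sup>+x. \<phi> x \<partial>lborel))"
    by simp
next
  fix c :: "'n \<Rightarrow> real"
  let ?f = "\<lambda>x::real ^ 'n. \<chi> i. c i * x $ i"
  have det: "det (matrix ?f) = (\<Prod>i\<in>UNIV. c i)"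
    by (simp add: axis_def matrix_def det_diagonal)
  show "det (matrix ?f) \<noteq> 0 \<longrightarrow> (\<forall>\<phi>\<in>borel_measurable borel.
           ennreal \<bar>det (matrix ?f)\<bar> * (\<integral>\<^sup>+x. \<phi> (?f x) \<partial>lborel) = (\<integral>\<^sup>+x. \<phi> x \<partial>lborel))"
  proof (intro impI ballI)
    fix \<phi> :: "real ^ 'n \<Rightarrow> ennreal"
    assume nz: "det (matrix ?f) \<noteq> 0" and [measurable]: "\<phi> \<in> borel_measurable borel"
    have f_eq: "0 + (\<Sum>j\<in>Basis. ((\<chi> i. c i) \<bullet> j * (x \<bullet> j)) *\<^sub>R j) = ?f x" for x
    proof -
      have "(\<Sum>j\<in>Basis. ((\<chi> i. c i) \<bullet> j * (x \<bullet> j)) *\<^sub>R j) =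
          (\<Sum>i\<in>UNIV. (c i * x $ i) *\<^sub>R axis i 1)"
        by (simp add: Basis_vec_def sum.UNION_disjoint axis_eq_axis inner_axis)
      then show ?thesis
        by (simp add: vec_eq_iff axis_def if_distrib cong: if_cong)
    qed
    have [measurable]: "?f \<in> borel_measurable borel"
      unfolding f_eq[symmetric] by measurable
    have prod_eq: "(\<Prod>j\<in>Basis. \<bar>(\<chi> i. c i) \<bullet> j\<bar>) = \<bar>det (matrix ?f)\<bar>"
      by (simp add: det Basis_vec_def prod.UNION_disjoint axis_eq_axis inner_axis abs_prod)
    have "(\<chi> i. c i) \<bullet> j \<noteq> 0" if "j \<in> Basis" for j
      using nz that by (auto simp: Basis_vec_def inner_axis det)
    then have "lborel = density (distr lborel borel ?f) (\<lambda>_. \<bar>det (matrix ?f)\<bar>)"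
      using lborel_affine_euclidean[of "\<lambda>j. (\<chi> i. c i) \<bullet> j" 0] unfolding f_eq prod_eq by blast
    then have "(\<integral>\<^sup>+x. \<phi> x \<partial>lborel) = (\<integral>\<^sup>+x. \<phi> x \<partial>density (distr lborel borel ?f) (\<lambda>_. \<bar>det (matrix ?f)\<bar>))"
      by simp
    then show "ennreal \<bar>det (matrix ?f)\<bar> * (\<integral>\<^sup>+x. \<phi> (?f x) \<partial>lborel) = (\<integral>\<^sup>+x. \<phi> x \<partial>lborel)"
      by (simp add: nn_integral_density nn_integral_distr nn_integral_cmult)
  qed
next
  fix m n :: 'n
  assume "m \<noteq> n"
  let ?p = "Transposition.transpose m n"
  let ?f = "\<lambda>x::real ^ 'n. \<chi> i. x $ ?p i"
  have perm: "?p permutes UNIV"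
    by (simp add: permutes_swap_id)
  have "matrix ?f = (\<chi> i. mat 1 $ ?p i)"
    by (auto simp: matrix_def mat_def axis_def vec_eq_iff)
  then have det: "\<bar>det (matrix ?f)\<bar> = 1"
    by (simp add: det_permute_rows[OF perm] sign_swap_id abs_mult)
  have [measurable]: "?f \<in> borel_measurable borel"
    by (intro borel_measurable_continuous_onI continuous_intros)
  have "lborel = distr lborel borel ?f"
  proof (rule lborel_eqI)
    fix l u :: "real ^ 'n"
    assume le: "\<And>b. b \<in> Basis \<Longrightarrow> l \<bullet> b \<le> u \<bullet> b"
    have le': "l $ i \<le> u $ i" for i
      using le[of "axis i 1"] by (auto simp: inner_axis)
    have "?f -` box l u = box (?f l) (?f u)"
      unfolding mem_box_cart set_eq_iff vimage_eq by (auto, (metis transpose_involutory)+)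
    moreover have "(\<Prod>b\<in>Basis. (?f u - ?f l) \<bullet> b) = (\<Prod>b\<in>Basis. (u - l) \<bullet> b)"
      using prod.permute[OF perm, of "\<lambda>i. u $ i - l $ i"]
      by (simp add: Basis_vec_def prod.UNION_disjoint axis_eq_axis inner_axis o_def)
    moreover have "?f l \<bullet> b \<le> ?f u \<bullet> b" if "b \<in> Basis" for b
      using le' that by (auto simp: Basis_vec_def inner_axis)
    ultimately show "emeasure (distr lborel borel ?f) (box l u) = (\<Prod>b\<in>Basis. (u - l) \<bullet> b)"
      by (simp add: emeasure_distr)
  qed simp
  then have "(\<integral>\<^sup>+x. \<phi> (?f x) \<partial>lborel) = (\<integral>\<^sup>+x. \<phi> x \<partial>lborel)" if "\<phi> \<in> borel_measurable borel"
    for \<phi> :: "real ^ 'n \<Rightarrow> ennreal"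
    using that nn_integral_distr[of ?f lborel borel \<phi>] by simp
  then show "det (matrix ?f) \<noteq> 0 \<longrightarrow> (\<forall>\<phi>\<in>borel_measurable borel.
           ennreal \<bar>det (matrix ?f)\<bar> * (\<integral>\<^sup>+x. \<phi> (?f x) \<partial>lborel) = (\<integral>\<^sup>+x. \<phi> x \<partial>lborel))"
    by (simp add: det)
next
  fix m n :: 'n
  assume "m \<noteq> n"
  let ?f = "\<lambda>x::real ^ 'n. \<chi> i. if i = m then x $ m + x $ n else x $ i"
  have "matrix ?f = (\<chi> k. if k = m then row m (mat 1) + 1 *s row n (mat 1) else row k (mat 1))"
    by (auto simp: matrix_def mat_def axis_def vec_eq_iff row_def)
  then have det: "det (matrix ?f) = 1"
    using \<open>m \<noteq> n\<close> by (simp add: det_row_operation)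
  have "linear ?f"
    by (rule linearI) (auto simp: vec_eq_iff algebra_simps)
  note borel_measurable_linear[OF this, measurable]
  show "det (matrix ?f) \<noteq> 0 \<longrightarrow> (\<forall>\<phi>\<in>borel_measurable borel.
           ennreal \<bar>det (matrix ?f)\<bar> * (\<integral>\<^sup>+x. \<phi> (?f x) \<partial>lborel) = (\<integral>\<^sup>+x. \<phi> x \<partial>lborel))"
  proof (intro impI ballI)
    fix \<phi> :: "real ^ 'n \<Rightarrow> ennreal"
    assume [measurable]: "\<phi> \<in> borel_measurable borel"
    show "ennreal \<bar>det (matrix ?f)\<bar> * (\<integral>\<^sup>+x. \<phi> (?f x) \<partial>lborel) = (\<integral>\<^sup>+x. \<phi> x \<partial>lborel)"
    proof -
      define J where "J = UNIV - {m}"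
      have J: "finite J" "m \<notin> J" "UNIV = insert m J"
        by (auto simp: J_def)
      have split: "(\<integral>\<^sup>+x. \<psi> x \<partial>lborel) =
          (\<integral>\<^sup>+t. (\<integral>\<^sup>+a. \<psi> (\<chi> i. (t(m := a)) i) \<partial>lborel) \<partial>Pi\<^sub>M J (\<lambda>_. lborel))"
        if "\<psi> \<in> borel_measurable borel" for \<psi> :: "real ^ 'n \<Rightarrow> ennreal"
      proof -
        have "(\<lambda>t. \<psi> (\<chi> i. t i)) \<in> borel_measurable (Pi\<^sub>M (insert m J) (\<lambda>_. lborel))"
          using that unfolding J(3)[symmetric] by measurable
        then show ?thesis
          unfolding nn_integral_lborel_vec[OF that] J(3)
          using J(1,2) by (intro lborels.product_nn_integral_insert)
      qed
      have "(\<integral>\<^sup>+a. \<phi> (?f (\<chi> i. (t(m := a)) i)) \<partial>lborel) = (\<integral>\<^sup>+a. \<phi> (\<chi> i. (t(m := a)) i) \<partial>lborel)"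
        if "t \<in> space (Pi\<^sub>M J (\<lambda>_. lborel))" for t
      proof -
        have "(\<lambda>a. \<chi> i. (t(m := a)) i) = (\<lambda>a. (\<chi> i. (t(m := 0)) i) + a *\<^sub>R axis m 1)"
          by (auto simp: fun_eq_iff vec_eq_iff axis_def)
        then have [measurable]: "(\<lambda>a. \<chi> i. (t(m := a)) i) \<in> borel_measurable borel"
          by simp
        have meas: "(\<lambda>a. \<phi> (\<chi> i. (t(m := a)) i)) \<in> borel_measurable borel"
          by measurable
        have "?f (\<chi> i. (t(m := a)) i) = (\<chi> i. (t(m := t n + 1 * a)) i)" for a
          using \<open>m \<noteq> n\<close> by (auto simp: vec_eq_iff)
        then show ?thesis
          using nn_integral_real_affine[OF meas, of 1 "t n"] by simp
      qed
      then show ?thesis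
        by (simp add: det split cong: nn_integral_cong)
    qed
  qed
qed

definition coordinate_space :: "'n::finite set \<Rightarrow> (real ^ 'n) set" where
  "coordinate_space I = {x. \<forall>i. i \<notin> I \<longrightarrow> x $ i = 0}"

definition integer_points :: "'n::finite set \<Rightarrow> (real ^ 'n) set" where
  "integer_points I = {x \<in> coordinate_space I. \<forall>i. x $ i \<in> \<int>}"

lemma coordinate_space_expand:
  fixes x :: "real ^ 'n::finite"
  assumes "x \<in> coordinate_space I"
  shows "(\<Sum>i\<in>I. (x $ i) *\<^sub>R axis i 1) = x"
  using assms
  by (auto simp: coordinate_space_def vec_eq_iff axis_def if_distrib cong: if_cong)

lemma subspace_coordinate_space: "subspace (coordinate_space I)"
  by (auto simp: subspace_def coordinate_space_def)

lemma axis_in_coordinate_space: "i \<in> I \<Longrightarrow> axis i c \<in> coordinate_space I"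
  by (auto simp: coordinate_space_def axis_def)

lemma span_axes: "span ((\<lambda>i::'n::finite. axis i (1::real)) ` I) = coordinate_space I"
proof (rule span_unique)
  show "coordinate_space I \<subseteq> V" if V: "(\<lambda>i. axis i (1::real)) ` I \<subseteq> V" "subspace V" for V
  proof
    fix x :: "real ^ 'n" assume "x \<in> coordinate_space I"
    then have "x = (\<Sum>i\<in>I. (x $ i) *\<^sub>R axis i 1)"
      by (simp add: coordinate_space_expand)
    also have "\<dots> \<in> V"
      using V by (intro subspace_sum subspace_scale) auto
    finally show "x \<in> V" .
  qed
qed (auto intro: subspace_coordinate_space axis_in_coordinate_space)

lemma inj_axis: "inj_on (\<lambda>i. axis i (1::real)) I"
  by (auto simp: inj_on_def axis_eq_axis)

lemma lattice_basis_axes: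
  fixes \<Lambda> :: "(real ^ 'n::finite) set"
  assumes \<Lambda>: "\<Lambda> \<inter> coordinate_space I = integer_points I"
  shows "lattice_basis \<Lambda> (coordinate_space I) ((\<lambda>i. axis i 1) ` I)"
proof -
  have "independent ((\<lambda>i. axis i 1) ` I :: (real ^ 'n) set)"
    by (rule independent_mono[OF independent_Basis]) (auto simp: Basis_vec_def)
  moreover have "integer_points I =
      {\<Sum>b\<in>(\<lambda>i. axis i 1) ` I. of_int (k b) *\<^sub>R b | k :: real ^ 'n \<Rightarrow> int. True}" (is "_ = ?R")
  proof
    show "integer_points I \<subseteq> ?R"
    proof
      fix x :: "real ^ 'n" assume x: "x \<in> integer_points I"
      have "x = (\<Sum>i\<in>I. (x $ i) *\<^sub>R axis i 1)"
        using x by (simp add: integer_points_def coordinate_space_expand)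
      also have "\<dots> = (\<Sum>i\<in>I. of_int \<lfloor>x \<bullet> axis i 1\<rfloor> *\<^sub>R axis i 1)"
        using x by (intro sum.cong refl arg_cong2[where f = scaleR])
          (auto simp: integer_points_def inner_axis elim!: Ints_cases dest: spec)
      also have "\<dots> = (\<Sum>b\<in>(\<lambda>i. axis i 1) ` I. of_int \<lfloor>x \<bullet> b\<rfloor> *\<^sub>R b)"
        by (simp add: sum.reindex[OF inj_axis])
      finally show "x \<in> ?R"
        by (auto intro: exI[of _ "\<lambda>b. \<lfloor>x \<bullet> b\<rfloor>"])
    qed
    show "?R \<subseteq> integer_points I"
    proof clarify
      fix k :: "real ^ 'n \<Rightarrow> int"
      have "(\<Sum>i\<in>I. of_int (k (axis i 1)) *\<^sub>R axis i 1) $ j =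
          (if j \<in> I then of_int (k (axis j 1)) else (0::real))" for j
        by (auto simp: axis_def if_distrib cong: if_cong)
      then show "(\<Sum>b\<in>(\<lambda>i. axis i 1) ` I. of_int (k b) *\<^sub>R b) \<in> integer_points I"
        by (simp add: sum.reindex[OF inj_axis] integer_points_def coordinate_space_def)
    qed
  qed
  ultimately show ?thesis
    unfolding lattice_basis_def \<Lambda> span_axes by simp
qed

lemma det_in_Ints:
  fixes A :: "real ^ 'n::finite ^ 'n"
  assumes "\<And>i j. A $ i $ j \<in> \<int>"
  shows "det A \<in> \<int>"
  unfolding det_def using assms by (intro Ints_sum Ints_mult Ints_prod Ints_of_int)

text \<open>
  Both determinants are integers, and their product is 1.
\<close>

lemma abs_det_integer_inverse:
  fixes f g :: "real ^ 'n::finite \<Rightarrow> real ^ 'n"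
  assumes "linear f" "linear g" "f \<circ> g = id"
    and f: "\<And>i j. f (axis i 1) $ j \<in> \<int>" and g: "\<And>i j. g (axis i 1) $ j \<in> \<int>"
  shows "\<bar>det (matrix f)\<bar> = 1"
proof -
  have "det (matrix f) \<in> \<int>" "det (matrix g) \<in> \<int>"
    using f g by (auto intro!: det_in_Ints simp: matrix_def)
  then obtain a b where ab: "det (matrix f) = of_int a" "det (matrix g) = of_int b"
    by (auto elim!: Ints_cases)
  have "det (matrix f) * det (matrix g) = det (matrix (f \<circ> g))"
    by (simp add: matrix_compose[OF assms(2,1)] det_mul)
  also have "\<dots> = 1"
    using assms(3) by (simp add: matrix_id_mat_1)
  finally have "of_int (a * b) = (1::real)"
    using ab by simp
  then have "a * b = 1"
    using of_int_eq_1_iff by blast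
  then have "\<bar>a\<bar> = 1"
    by (metis abs_zmult_eq_1 abs_1)
  then show ?thesis
    by (simp add: ab flip: of_int_abs)
qed

lemma nn_integral_PiM_reindex:
  fixes \<beta> :: "'i \<Rightarrow> 'j" and f :: "('j \<Rightarrow> real) \<Rightarrow> ennreal"
  assumes I: "finite I" and \<beta>: "bij_betw \<beta> I B"
    and [measurable]: "f \<in> borel_measurable (Pi\<^sub>M B (\<lambda>_. lborel))"
  shows "(\<integral>\<^sup>+t. f t \<partial>Pi\<^sub>M B (\<lambda>_. lborel)) =
         (\<integral>\<^sup>+t. f (\<lambda>b\<in>B. t (inv_into I \<beta> b)) \<partial>Pi\<^sub>M I (\<lambda>_. lborel))"
proof -
  let ?g = "\<lambda>t. \<lambda>b\<in>B. t (inv_into I \<beta> b)"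
  have B: "finite B" "B = \<beta> ` I" "inj_on \<beta> I"
    using I \<beta> by (auto simp: bij_betw_def)
  have g[measurable]: "?g \<in> measurable (Pi\<^sub>M I (\<lambda>_. lborel :: real measure)) (Pi\<^sub>M B (\<lambda>_. lborel))"
    using B by (intro measurable_restrict measurable_component_singleton) (auto intro: inv_into_into)
  have "distr (Pi\<^sub>M I (\<lambda>_. lborel)) (Pi\<^sub>M B (\<lambda>_. lborel)) ?g = Pi\<^sub>M B (\<lambda>_. lborel :: real measure)"
  proof (rule lborels.PiM_eqI)
    fix A :: "'j \<Rightarrow> real set" assume A: "\<And>b. b \<in> B \<Longrightarrow> A b \<in> sets lborel"
    have "?g -` Pi\<^sub>E B A \<inter> space (Pi\<^sub>M I (\<lambda>_. lborel)) = Pi\<^sub>E I (\<lambda>i. A (\<beta> i))"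
      using B by (auto simp: space_PiM PiE_iff)
    then have "emeasure (distr (Pi\<^sub>M I (\<lambda>_. lborel)) (Pi\<^sub>M B (\<lambda>_. lborel)) ?g) (Pi\<^sub>E B A) =
        (\<Prod>i\<in>I. emeasure lborel (A (\<beta> i)))"
      using A B(1) I bij_betwE[OF \<beta>] g
      by (subst emeasure_distr) (auto intro!: sets_PiM_I_finite lborels.emeasure_PiM)
    then show "emeasure (distr (Pi\<^sub>M I (\<lambda>_. lborel)) (Pi\<^sub>M B (\<lambda>_. lborel)) ?g) (Pi\<^sub>E B A) =
        (\<Prod>b\<in>B. emeasure lborel (A b))"
      using prod.reindex_bij_betw[OF \<beta>, of "\<lambda>b. emeasure lborel (A b)"] by simp
  qed (use B in auto)
  then have "(\<integral>\<^sup>+t. f t \<partial>Pi\<^sub>M B (\<lambda>_. lborel)) =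
      (\<integral>\<^sup>+t. f t \<partial>distr (Pi\<^sub>M I (\<lambda>_. lborel)) (Pi\<^sub>M B (\<lambda>_. lborel)) ?g)"
    by simp
  then show ?thesis
    by (simp add: nn_integral_distr)
qed

text \<open>
  The measure on a coordinate subspace is recovered from that on the whole space by thickening with a
  unit cube in the complementary directions.
\<close>

lemma nn_integral_lborel_slab:
  fixes \<phi> :: "real ^ 'n::finite \<Rightarrow> ennreal"
  assumes [measurable]: "\<phi> \<in> borel_measurable borel"
  shows "(\<integral>\<^sup>+x. \<phi> (\<Sum>i\<in>I. (x $ i) *\<^sub>R axis i 1) * (\<Prod>i\<in>- I. indicator {0..1} (x $ i)) \<partial>lborel) =
         (\<integral>\<^sup>+t. \<phi> (\<Sum>i\<in>I. t i *\<^sub>R axis i 1) \<partial>Pi\<^sub>M I (\<lambda>_. lborel))"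
proof -
  let ?\<psi> = "\<lambda>t::'n \<Rightarrow> real. \<phi> (\<Sum>i\<in>I. t i *\<^sub>R axis i 1) * (\<Prod>i\<in>- I. indicator {0..1::real} (t i))"
  have "?\<psi> \<in> borel_measurable (Pi\<^sub>M UNIV (\<lambda>_. lborel))"
    by measurable
  then have \<psi>: "?\<psi> \<in> borel_measurable (Pi\<^sub>M (I \<union> - I) (\<lambda>_. lborel))"
    by simp
  have [measurable]: "(\<lambda>x::real ^ 'n. \<phi> (\<Sum>i\<in>I. (x $ i) *\<^sub>R axis i 1) * (\<Prod>i\<in>- I. indicator {0..1} (x $ i)))
      \<in> borel_measurable borel"
    by measurable
  have "(\<integral>\<^sup>+x. \<phi> (\<Sum>i\<in>I. (x $ i) *\<^sub>R axis i 1) * (\<Prod>i\<in>- I. indicator {0..1} (x $ i)) \<partial>lborel) =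
      (\<integral>\<^sup>+t. ?\<psi> t \<partial>Pi\<^sub>M (I \<union> - I) (\<lambda>_. lborel))"
    by (subst nn_integral_lborel_vec) simp_all
  also have "\<dots> = (\<integral>\<^sup>+s. \<integral>\<^sup>+t. ?\<psi> (merge I (- I) (s, t)) \<partial>Pi\<^sub>M (- I) (\<lambda>_. lborel) \<partial>Pi\<^sub>M I (\<lambda>_. lborel))"
    using \<psi> by (intro lborels.product_nn_integral_fold) auto
  also have "\<dots> = (\<integral>\<^sup>+s. \<integral>\<^sup>+t. \<phi> (\<Sum>i\<in>I. s i *\<^sub>R axis i 1) * (\<Prod>i\<in>- I. indicator {0..1::real} (t i))
      \<partial>Pi\<^sub>M (- I) (\<lambda>_. lborel) \<partial>Pi\<^sub>M I (\<lambda>_. lborel))"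
    by (intro nn_integral_cong arg_cong2[where f = "(*)"] arg_cong[where f = \<phi>] sum.cong prod.cong)
       (auto simp: merge_def)
  also have "\<dots> = (\<integral>\<^sup>+s. \<phi> (\<Sum>i\<in>I. s i *\<^sub>R axis i 1) \<partial>Pi\<^sub>M I (\<lambda>_. lborel))"
  proof (rule nn_integral_cong)
    fix s :: "'n \<Rightarrow> real"
    have "(\<integral>\<^sup>+t. (\<Prod>i\<in>- I. indicator {0..1::real} (t i)) \<partial>Pi\<^sub>M (- I) (\<lambda>_. lborel)) =
        (\<Prod>i\<in>- I. (\<integral>\<^sup>+a. indicator {0..1::real} a \<partial>lborel))"
      by (intro lborels.product_nn_integral_prod) auto
    also have "\<dots> = 1"
      by simp
    finally show "(\<integral>\<^sup>+t. \<phi> (\<Sum>i\<in>I. s i *\<^sub>R axis i 1) * (\<Prod>i\<in>- I. indicator {0..1::real} (t i))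
        \<partial>Pi\<^sub>M (- I) (\<lambda>_. lborel)) = \<phi> (\<Sum>i\<in>I. s i *\<^sub>R axis i 1)"
      by (subst nn_integral_cmult) simp_all
  qed
  finally show ?thesis .
qed

text \<open>
  A change of lattice basis of the subspace, extended by the identity on the other axes, is an
  integer matrix with integer inverse, hence preserves the Lebesgue measure of the whole space; the unit
  cube used for thickening is left unchanged.
\<close>

lemma nn_integral_lattice_basis:
  fixes \<phi> :: "real ^ 'n::finite \<Rightarrow> ennreal"
  assumes \<Lambda>: "\<Lambda> \<inter> coordinate_space I = integer_points I"
    and B: "lattice_basis \<Lambda> (coordinate_space I) B"
    and [measurable]: "\<phi> \<in> borel_measurable borel"
  shows "(\<integral>\<^sup>+t. \<phi> (\<Sum>b\<in>B. t b *\<^sub>R b) \<partial>Pi\<^sub>M B (\<lambda>_. lborel)) =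
         (\<integral>\<^sup>+t. \<phi> (\<Sum>i\<in>I. t i *\<^sub>R axis i 1) \<partial>Pi\<^sub>M I (\<lambda>_. lborel))"
proof -
  have fin: "finite B" and ind: "independent B" and span: "span B = coordinate_space I"
    and ints: "integer_points I = {\<Sum>b\<in>B. of_int (k b) *\<^sub>R b | k :: real ^ 'n \<Rightarrow> int. True}"
    using B \<Lambda> by (auto simp: lattice_basis_def)
  have "card B = dim (span B)"
    using ind by (simp add: dim_eq_card_independent)
  also have "\<dots> = dim (span ((\<lambda>i. axis i (1::real)) ` I))"
    by (simp only: span span_axes)
  also have "\<dots> = card ((\<lambda>i. axis i (1::real)) ` I)"
    unfolding dim_span
    by (intro dim_eq_card_independent independent_mono[OF independent_Basis]) (auto simp: Basis_vec_def)
  also have "\<dots> = card I"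
    by (simp add: card_image[OF inj_axis])
  finally obtain \<beta> where \<beta>: "bij_betw \<beta> I B"
    using fin by (metis finite finite_same_card_bij)
  have \<beta>_int: "\<beta> i \<in> integer_points I" if "i \<in> I" for i
  proof -
    have b: "\<beta> i \<in> B"
      using \<beta> that by (auto simp: bij_betw_def)
    have "(\<Sum>b\<in>B. of_int (if b = \<beta> i then 1 else 0) *\<^sub>R b) = (\<Sum>b\<in>B. if b = \<beta> i then b else 0)"
      by (intro sum.cong) auto
    also have "\<dots> = \<beta> i"
      using fin b by simp
    finally show ?thesis
      unfolding ints
      by (intro CollectI exI[of _ "\<lambda>b. if b = \<beta> i then 1 else 0"] conjI TrueI) (rule sym)
  qed
  have "\<exists>k. axis i 1 = (\<Sum>b\<in>B. of_int (k b :: int) *\<^sub>R b)" if "i \<in> I" for i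
  proof -
    have "axis i 1 \<in> integer_points I"
      using that axis_in_coordinate_space[OF that] by (auto simp: integer_points_def axis_def)
    then show ?thesis
      unfolding ints by blast
  qed
  then obtain k where k: "\<And>i. i \<in> I \<Longrightarrow> axis i 1 = (\<Sum>b\<in>B. of_int (k i b :: int) *\<^sub>R b)"
    by metis
  \<comment> \<open>The extended change of basis and its inverse.\<close>
  define f where "f x = (\<Sum>i\<in>UNIV. (x $ i) *\<^sub>R (if i \<in> I then \<beta> i else axis i 1))" for x :: "real ^ 'n"
  define g where "g x = ((\<Sum>i\<in>UNIV. (x $ i) *\<^sub>R
      (if i \<in> I then \<Sum>j\<in>I. of_int (k i (\<beta> j)) *\<^sub>R axis j 1 else axis i 1)) :: real ^ 'n)" for x :: "real ^ 'n"
  have lin: "linear f" "linear g"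
    by (auto intro!: linearI simp: f_def g_def scaleR_add_left sum.distrib scaleR_sum_right)
  note borel_measurable_linear[OF lin(1), measurable]
  have axis_sum: "(\<Sum>i\<in>UNIV. (axis j 1 $ i) *\<^sub>R v i) = v j" for j and v :: "'n \<Rightarrow> real ^ 'n"
  proof -
    have "(\<Sum>i\<in>UNIV. (axis j 1 $ i) *\<^sub>R v i) = (\<Sum>i\<in>UNIV. if i = j then v i else 0)"
      by (intro sum.cong) (auto simp: axis_def)
    then show ?thesis by simp
  qed
  have f_axis: "f (axis j 1) = (if j \<in> I then \<beta> j else axis j 1)" for j
    unfolding f_def by (rule axis_sum)
  have g_axis: "g (axis i 1) = (if i \<in> I then \<Sum>j\<in>I. of_int (k i (\<beta> j)) *\<^sub>R axis j 1 else axis i 1)" for i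
    unfolding g_def by (rule axis_sum)
  have fg: "f (g (axis i 1)) = axis i 1" for i
  proof (cases "i \<in> I")
    case True
    then have "f (g (axis i 1)) = (\<Sum>j\<in>I. of_int (k i (\<beta> j)) *\<^sub>R \<beta> j)"
      by (simp add: g_axis f_axis linear_sum[OF lin(1)] linear_cmul[OF lin(1)])
    also have "\<dots> = (\<Sum>b\<in>B. of_int (k i b) *\<^sub>R b)"
      by (rule sum.reindex_bij_betw[OF \<beta>])
    finally show ?thesis
      using k[OF True] by simp
  qed (simp add: f_axis g_axis)
  have axis_int: "axis i 1 $ j \<in> (\<int> :: real set)" for i j :: 'n
    by (simp add: axis_def)
  have "f \<circ> g = id"
  proof (rule linear_eq_stdbasis)
    show "(f \<circ> g) b = id b" if "b \<in> Basis" for b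
      using that fg by (auto simp: Basis_vec_def)
  qed (use lin in \<open>auto intro: linear_compose linear_id\<close>)
  moreover have "f (axis i 1) $ j \<in> \<int>" for i j
    using \<beta>_int axis_int by (auto simp: f_axis integer_points_def)
  moreover have "g (axis i 1) $ j \<in> \<int>" for i j
    using axis_int by (auto simp: g_axis intro!: Ints_sum Ints_mult)
  ultimately have det: "\<bar>det (matrix f)\<bar> = 1"
    using lin by (intro abs_det_integer_inverse)
  define P where "P x = ((\<Sum>i\<in>I. (x $ i) *\<^sub>R axis i 1) :: real ^ 'n)" for x :: "real ^ 'n"
  define q where "q x = (\<Prod>i\<in>- I. indicator {0..1} (x $ i) :: ennreal)" for x :: "real ^ 'n"
  have f_out: "f x $ i = x $ i" if "i \<notin> I" for x i
  proof -
    have "f x $ i = (\<Sum>j\<in>UNIV. if j = i then x $ j else 0)"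
      unfolding f_def sum_component
      using \<beta>_int that by (intro sum.cong) (auto simp: integer_points_def coordinate_space_def axis_def)
    then show ?thesis by simp
  qed
  have fP: "f (P x) = (\<Sum>i\<in>I. (x $ i) *\<^sub>R \<beta> i)" for x
    unfolding P_def by (simp add: linear_sum[OF lin(1)] linear_cmul[OF lin(1)] f_axis)
  have Pf: "P (f x) = f (P x)" for x
  proof -
    have "f (P x) \<in> coordinate_space I"
      unfolding fP using \<beta>_int
      by (intro subspace_sum subspace_scale subspace_coordinate_space) (auto simp: integer_points_def)
    moreover have "P (f x) \<in> coordinate_space I"
      unfolding P_def by (intro subspace_sum subspace_scale subspace_coordinate_space axis_in_coordinate_space)
    moreover have "P (f x) $ i = f (P x) $ i" if "i \<in> I" for i
    proof -
      have "P (f x) $ i = f x $ i"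
        using that by (simp add: P_def axis_def if_distrib cong: if_cong)
      also have "\<dots> = (\<Sum>j\<in>UNIV. if j \<in> I then x $ j * \<beta> j $ i else 0)"
        unfolding f_def sum_component using that by (intro sum.cong) (auto simp: axis_def)
      also have "\<dots> = f (P x) $ i"
        unfolding fP by (simp add: sum.If_cases)
      finally show ?thesis .
    qed
    ultimately show ?thesis
      unfolding vec_eq_iff coordinate_space_def mem_Collect_eq by metis
  qed
  have "(\<integral>\<^sup>+t. \<phi> (\<Sum>b\<in>B. t b *\<^sub>R b) \<partial>Pi\<^sub>M B (\<lambda>_. lborel)) =
      (\<integral>\<^sup>+t. \<phi> (\<Sum>b\<in>B. (\<lambda>b\<in>B. t (inv_into I \<beta> b)) b *\<^sub>R b) \<partial>Pi\<^sub>M I (\<lambda>_. lborel))"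
    using \<beta> by (intro nn_integral_PiM_reindex) auto
  also have "\<dots> = (\<integral>\<^sup>+t. (\<phi> \<circ> f) (\<Sum>i\<in>I. t i *\<^sub>R axis i 1) \<partial>Pi\<^sub>M I (\<lambda>_. lborel))"
  proof (intro nn_integral_cong)
    fix t :: "'n \<Rightarrow> real"
    have "(\<Sum>b\<in>B. (\<lambda>b\<in>B. t (inv_into I \<beta> b)) b *\<^sub>R b) = (\<Sum>b\<in>B. t (inv_into I \<beta> b) *\<^sub>R b)"
      by (intro sum.cong) auto
    also have "\<dots> = (\<Sum>i\<in>I. t (inv_into I \<beta> (\<beta> i)) *\<^sub>R \<beta> i)"
      by (rule sum.reindex_bij_betw[OF \<beta>, symmetric])
    also have "\<dots> = (\<Sum>i\<in>I. t i *\<^sub>R \<beta> i)"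
      using \<beta> by (intro sum.cong) (auto simp: bij_betw_def)
    also have "\<dots> = f (\<Sum>i\<in>I. t i *\<^sub>R axis i 1)"
      by (simp add: linear_sum[OF lin(1)] linear_cmul[OF lin(1)] f_axis)
    finally show "\<phi> (\<Sum>b\<in>B. (\<lambda>b\<in>B. t (inv_into I \<beta> b)) b *\<^sub>R b) = (\<phi> \<circ> f) (\<Sum>i\<in>I. t i *\<^sub>R axis i 1)"
      by simp
  qed
  also have "\<dots> = (\<integral>\<^sup>+x. (\<phi> \<circ> f) (P x) * q x \<partial>lborel)"
    unfolding P_def q_def by (subst nn_integral_lborel_slab) (simp_all add: comp_def)
  also have "\<dots> = (\<integral>\<^sup>+x. \<phi> (P (f x)) * q (f x) \<partial>lborel)"
    by (simp add: Pf q_def f_out)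
  also have "\<dots> = (\<integral>\<^sup>+x. \<phi> (P x) * q x \<partial>lborel)"
  proof -
    have "(\<lambda>x. \<phi> (P x) * q x) \<in> borel_measurable borel"
      unfolding P_def q_def by measurable
    then show ?thesis
      using nn_integral_linear_change[OF lin(1)] det by fastforce
  qed
  also have "\<dots> = (\<integral>\<^sup>+t. \<phi> (\<Sum>i\<in>I. t i *\<^sub>R axis i 1) \<partial>Pi\<^sub>M I (\<lambda>_. lborel))"
    unfolding P_def q_def by (rule nn_integral_lborel_slab) simp
  finally show ?thesis .
qed

lemma nn_integral_lattice_measure:
  fixes \<phi> :: "real ^ 'n::finite \<Rightarrow> ennreal"
  assumes \<Lambda>: "\<Lambda> \<inter> coordinate_space I = integer_points I"
    and [measurable]: "\<phi> \<in> borel_measurable borel"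
  shows "(\<integral>\<^sup>+x. \<phi> x \<partial>lattice_measure \<Lambda> (coordinate_space I)) =
         (\<integral>\<^sup>+t. \<phi> (\<Sum>i\<in>I. t i *\<^sub>R axis i 1) \<partial>Pi\<^sub>M I (\<lambda>_. lborel))"
proof -
  define B where "B = (SOME B. lattice_basis \<Lambda> (coordinate_space I) B)"
  have B: "lattice_basis \<Lambda> (coordinate_space I) B"
    unfolding B_def by (rule someI) (rule lattice_basis_axes[OF \<Lambda>])
  show ?thesis
    unfolding lattice_measure_def Let_def B_def[symmetric]
    by (simp add: nn_integral_distr nn_integral_lattice_basis[OF \<Lambda> B])
qed

section \<open>Laplace transforms of cones in coordinate subspaces\<close>

lemma sets_lattice_measure [simp, measurable_cong]: "sets (lattice_measure \<Lambda> V) = sets borel"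
  by (simp add: lattice_measure_def Let_def)

definition orthant :: "'n::finite set \<Rightarrow> (real ^ 'n) set" where
  "orthant I = {x \<in> coordinate_space I. \<forall>i. 0 \<le> x $ i}"

lemma sum_axis_nth:
  "(\<Sum>i\<in>I. t i *\<^sub>R axis i (1::real)) $ j = (if j \<in> I then t j else 0)" for I :: "'n::finite set"
  by (simp add: axis_def if_distrib cong: if_cong)

lemma sum_axis_in_orthant_iff:
  "(\<Sum>i\<in>I. t i *\<^sub>R axis i 1) \<in> orthant I \<longleftrightarrow> (\<forall>i\<in>I. 0 \<le> t i)"
  unfolding orthant_def coordinate_space_def mem_Collect_eq sum_axis_nth by auto

text \<open>
  All integrals are taken of nonnegative functions, so the dissection gives the value of the Laplace
  integral at every \<open>y\<close> in the interior of the dual cone.  There each generator of a piece is a nonzero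
  element of \<open>C\<close>, hence positive on \<open>y\<close>, and no denominator vanishes.
\<close>

lemma cone_laplace_dissection:
  fixes C :: "(real ^ 'n::finite) set"
  assumes \<Lambda>: "\<Lambda> \<inter> coordinate_space I = integer_points I"
    and span: "span C = coordinate_space I" and orthant: "C \<subseteq> orthant I"
    and C[measurable]: "C \<in> sets borel"
    and W: "\<And>w i. w \<in> set W \<Longrightarrow> i \<in> I \<Longrightarrow> w i \<in> C - {0}"
    and dissects: "dissects I (\<lambda>i. axis i 1) C W"
  shows "cone_laplace \<Lambda> C = (\<Sum>w\<leftarrow>W. \<Prod>i\<in>I. inv_linear (w i))"
proof -
  let ?D = "{y. \<forall>x\<in>C. x \<noteq> 0 \<longrightarrow> 0 < x \<bullet> y}"
  let ?h = "\<lambda>y. LINT x:C|lattice_measure \<Lambda> (span C). exp (- (x \<bullet> y))"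
  have h: "?h y = (\<Sum>w\<leftarrow>W. \<Prod>i\<in>I. 1 / (w i \<bullet> y))" if y: "y \<in> ?D" for y
  proof -
    have nonneg: "0 \<le> (\<Prod>i\<in>I. 1 / (w i \<bullet> y))" if "w \<in> set W" for w
      using y W[OF that] by (intro prod_nonneg) (auto simp: less_imp_le)
    have "?h y = enn2real (\<integral>\<^sup>+x. ennreal (indicator C x *\<^sub>R exp (- (x \<bullet> y))) \<partial>lattice_measure \<Lambda> (span C))"
      unfolding set_lebesgue_integral_def by (intro integral_eq_nn_integral) auto
    also have "(\<integral>\<^sup>+x. ennreal (indicator C x *\<^sub>R exp (- (x \<bullet> y))) \<partial>lattice_measure \<Lambda> (span C)) =
        (\<integral>\<^sup>+x. ennreal (exp (- (x \<bullet> y))) * indicator C x \<partial>lattice_measure \<Lambda> (span C))"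
      by (intro nn_integral_cong) (auto simp: indicator_def)
    also have "\<dots> = (\<integral>\<^sup>+t. ennreal (exp (- ((\<Sum>i\<in>I. t i *\<^sub>R axis i 1) \<bullet> y))) *
        indicator C (\<Sum>i\<in>I. t i *\<^sub>R axis i 1) \<partial>Pi\<^sub>M I (\<lambda>_. lborel))"
      unfolding span by (rule nn_integral_lattice_measure[OF \<Lambda>]) simp
    also have "\<dots> = simplicial_integral I (\<lambda>i. axis i 1) (\<lambda>x. ennreal (exp (- (x \<bullet> y))) * indicator C x)"
      unfolding simplicial_integral_def
    proof (intro nn_integral_cong)
      fix t :: "'n \<Rightarrow> real"
      have "(\<Sum>i\<in>I. t i *\<^sub>R axis i 1) \<in> C \<Longrightarrow> \<forall>i\<in>I. 0 \<le> t i"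
        using orthant sum_axis_in_orthant_iff[where I = I and t = t] by blast
      then show "ennreal (exp (- ((\<Sum>i\<in>I. t i *\<^sub>R axis i 1) \<bullet> y))) * indicator C (\<Sum>i\<in>I. t i *\<^sub>R axis i 1) =
          ennreal (exp (- ((\<Sum>i\<in>I. t i *\<^sub>R axis i 1) \<bullet> y))) * indicator C (\<Sum>i\<in>I. t i *\<^sub>R axis i 1) *
          indicator {t. \<forall>i\<in>I. 0 \<le> t i} t"
        by (auto simp: indicator_def)
    qed
    also have "\<dots> = (\<Sum>w\<leftarrow>W. simplicial_integral I w (\<lambda>x. ennreal (exp (- (x \<bullet> y)))))"
      using dissects unfolding dissects_def by simp
    also have "\<dots> = (\<Sum>w\<leftarrow>W. ennreal (\<Prod>i\<in>I. 1 / (w i \<bullet> y)))"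
      using y W by (intro arg_cong[where f = sum_list] map_cong refl simplicial_integral_exp) auto
    also have "\<dots> = ennreal (\<Sum>w\<leftarrow>W. \<Prod>i\<in>I. 1 / (w i \<bullet> y))"
      using nonneg by (rule sum_list_ennreal)
    also have "enn2real \<dots> = (\<Sum>w\<leftarrow>W. \<Prod>i\<in>I. 1 / (w i \<bullet> y))"
      using nonneg by (intro enn2real_ennreal sum_list_nonneg) auto
    finally show ?thesis .
  qed
  have "represents (\<Sum>w\<leftarrow>W. \<Prod>i\<in>I. inv_linear (w i)) (\<lambda>y. \<Sum>w\<leftarrow>W. \<Prod>i\<in>I. 1 / (w i \<bullet> y)) ?D"
    using W by (intro represents_sum_list represents_prod represents_inv_linear) (auto simp: less_imp_neq[symmetric])
  then have rep: "represents (\<Sum>w\<leftarrow>W. \<Prod>i\<in>I. inv_linear (w i)) ?h ?D"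
    by (rule represents_cong) (simp add: h)
  \<comment> \<open>An open set of convergence, which makes the representing rational function unique.\<close>
  have "{y::real ^ 'n. \<forall>i. 0 < y $ i} \<subseteq> ?D"
  proof clarify
    fix x y :: "real ^ 'n" assume y: "\<forall>i. 0 < y $ i" and x: "x \<in> C" "x \<noteq> 0"
    have nonneg: "0 \<le> x $ i" for i
      using x(1) orthant by (auto simp: orthant_def)
    obtain j where "x $ j \<noteq> 0"
      using x(2) by (auto simp: vec_eq_iff)
    then have "0 < x $ j"
      using nonneg[of j] by simp
    then show "0 < x \<bullet> y"
      unfolding inner_vec_def using y nonneg by (intro sum_pos2[of _ j]) (auto simp: less_imp_le)
  qed
  moreover have "open {y::real ^ 'n. \<forall>i. 0 < y $ i}"
    unfolding Collect_all_eq by (intro open_INT open_Collect_less continuous_intros ballI) auto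
  moreover have "(\<chi> i. 1) \<in> {y::real ^ 'n. \<forall>i. 0 < y $ i}"
    by simp
  ultimately have "interior ?D \<noteq> {}"
    by (metis (no_types, lifting) empty_iff interior_maximal subsetD)
  then show ?thesis
    unfolding cone_laplace_def using rep by (intro the_equality represents_unique)
qed

lemma orthant_borel [measurable]: "orthant I \<in> sets borel"
proof -
  have "closed (orthant I)"
    unfolding orthant_def coordinate_space_def mem_Collect_eq Collect_conj_eq
    by (intro closed_Int closed_Collect_all closed_Collect_imp open_Collect_const closed_Collect_eq
        closed_Collect_le continuous_intros)
  then show ?thesis by (rule borel_closed)
qed

lemma axis_in_orthant: "i \<in> I \<Longrightarrow> axis i 1 \<in> orthant I"
  by (auto simp: orthant_def coordinate_space_def axis_def)

lemma span_eq_coordinate_space: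
  assumes "C \<subseteq> coordinate_space I" and "\<And>i. i \<in> I \<Longrightarrow> axis i 1 \<in> span C"
  shows "span C = coordinate_space I"
proof
  show "span C \<subseteq> coordinate_space I"
    using assms(1) by (rule span_minimal) (rule subspace_coordinate_space)
  show "coordinate_space I \<subseteq> span C"
    unfolding span_axes[symmetric] using assms(2) by (intro span_minimal) auto
qed

lemma cone_laplace_orthant:
  fixes I :: "'n::finite set"
  assumes "\<Lambda> \<inter> coordinate_space I = integer_points I"
  shows "cone_laplace \<Lambda> (orthant I) = (\<Prod>i\<in>I. 1 / rvar i)"
proof -
  have "cone_laplace \<Lambda> (orthant I) = (\<Sum>w\<leftarrow>[\<lambda>i. axis i 1]. \<Prod>i\<in>I. inv_linear (w i))"
  proof (rule cone_laplace_dissection[OF assms])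
    show "span (orthant I) = coordinate_space I"
    proof (rule span_eq_coordinate_space)
      show "orthant I \<subseteq> coordinate_space I"
        by (auto simp: orthant_def)
    qed (intro span_base axis_in_orthant)
    show "dissects I (\<lambda>i. axis i 1) (orthant I) [\<lambda>i. axis i 1]"
      by (rule dissects_trivial) (simp add: sum_axis_in_orthant_iff)
  qed (auto simp: axis_in_orthant axis_eq_0_iff)
  then show ?thesis
    by (simp add: inv_linear_axis)
qed

text \<open>
  The axes other than \<open>e\<close> are tilted towards \<open>e\<close> one after the other.  Each step splits off one cone in
  which the generator \<open>e\<close> has been replaced, so that no multiple of \<open>e\<close> is left among its generators;
  since all vectors are nonnegative, positive combinations never produce one again.
\<close>

lemma dissect_around_axis:
  fixes I :: "'n::finite set"
  assumes e: "e \<in> I" and \<kappa>: "\<And>i. i \<in> I \<Longrightarrow> 0 < \<kappa> i"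
  shows "\<exists>W. (\<forall>w\<in>set W. \<forall>i\<in>I. w i \<in> orthant I \<and> (\<exists>j. j \<noteq> e \<and> w i $ j \<noteq> 0)) \<and>
     dissects I (\<lambda>i. axis i 1) UNIV ((\<lambda>i. if i = e then axis e 1 else axis i 1 + \<kappa> i *\<^sub>R axis e 1) # W)"
proof -
  define v where "v J i = (if i \<in> J then axis i 1 + \<kappa> i *\<^sub>R axis e 1 else axis i 1 :: real ^ 'n)" for J i
  let ?X = "{x \<in> orthant I. \<exists>j. j \<noteq> e \<and> x $ j \<noteq> 0}"
  have "\<exists>W. (\<forall>w\<in>set W. w \<in> I \<rightarrow> ?X) \<and> dissects I (\<lambda>i. axis i 1) UNIV (v J # W)"
    if "J \<subseteq> I - {e}" for J
    using finite[of J] that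
  proof (induction J rule: finite_induct)
    case empty
    then show ?case
      by (intro exI[of _ "[]"]) (auto simp: v_def[abs_def] intro: dissects_trivial)
  next
    case (insert j J)
    then obtain W where W: "\<forall>w\<in>set W. w \<in> I \<rightarrow> ?X" "dissects I (\<lambda>i. axis i 1) UNIV (v J # W)"
      by auto
    have j: "j \<in> I" "e \<noteq> j" "j \<notin> J" "e \<notin> J"
      using insert by auto
    define u where "u = (v J)(e := v J e + (1 / \<kappa> j) *\<^sub>R v J j)"
    have v_insert: "(v J)(j := v J j + \<kappa> j *\<^sub>R v J e) = v (insert j J)"
      using j by (auto simp: v_def fun_eq_iff)
    have "dissects I (\<lambda>i. axis i 1) UNIV (v (insert j J) # u # W)"
      unfolding dissects_def
    proof
      fix \<phi> :: "real ^ 'n \<Rightarrow> ennreal" assume [measurable]: "\<phi> \<in> borel_measurable borel"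
      have "simplicial_integral I (v J) \<phi> =
          simplicial_integral I (v (insert j J)) \<phi> + simplicial_integral I u \<phi>"
        unfolding u_def v_insert[symmetric]
        using e j \<kappa>[OF j(1)] by (intro simplicial_integral_split) auto
      then show "simplicial_integral I (\<lambda>i. axis i 1) (\<lambda>x. \<phi> x * indicator UNIV x) =
          (\<Sum>w\<leftarrow>v (insert j J) # u # W. simplicial_integral I w \<phi>)"
        using W(2) by (simp add: dissects_def add.assoc)
    qed
    moreover have "u i \<in> ?X" if "i \<in> I" for i
    proof -
      have "0 < \<kappa> i" "0 < \<kappa> j"
        using \<kappa> j that by auto
      then have "u i \<in> orthant I"
        using that e j by (auto simp: u_def v_def orthant_def coordinate_space_def axis_def)
      moreover have "u i $ (if i = e then j else i) \<noteq> 0"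
        using \<open>0 < \<kappa> i\<close> \<open>0 < \<kappa> j\<close> that e j by (auto simp: u_def v_def axis_def)
      ultimately show ?thesis
        using j(2) by (auto split: if_splits)
    qed
    ultimately show ?case
      using W(1) by (intro exI[of _ "u # W"]) auto
  qed
  from this[of "I - {e}"] obtain W where
    W: "\<forall>w\<in>set W. w \<in> I \<rightarrow> ?X" "dissects I (\<lambda>i. axis i 1) UNIV (v (I - {e}) # W)"
    by auto
  have "simplicial_integral I (v (I - {e})) \<phi> =
      simplicial_integral I (\<lambda>i. if i = e then axis e 1 else axis i 1 + \<kappa> i *\<^sub>R axis e 1) \<phi>" for \<phi>
    by (intro simplicial_integral_cong) (auto simp: v_def)
  then show ?thesis
    using W by (intro exI[of _ W]) (auto simp: dissects_def Pi_iff)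
qed

text \<open>
  The main piece is spanned by \<open>e\<close> and by tilted axes that satisfy all inequalities, and it alone has
  the factor \<open>1 / y\<^sub>e\<close>.  The generators of the other pieces restrict to nonzero linear forms on
  \<open>y\<^sub>e = 0\<close>, so these pieces vanish after multiplication by \<open>y\<^sub>e\<close> and restriction.
\<close>

lemma residue_cone_laplace:
  fixes I :: "'n::finite set"
  assumes \<Lambda>: "\<Lambda> \<inter> coordinate_space I = integer_points I"
    and e: "e \<in> I" and A: "finite A" and lin: "\<And>c. c \<in> A \<Longrightarrow> linear c"
    and pos: "\<And>c. c \<in> A \<Longrightarrow> 0 < (c (axis e 1) :: real)"
  shows "has_residue e (cone_laplace \<Lambda> (orthant I \<inter> {x. \<forall>c\<in>A. 0 \<le> c x})) (\<Prod>i\<in>I - {e}. 1 / rvar i)"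
proof -
  let ?K = "{x. \<forall>c\<in>A. 0 \<le> c x}"
  let ?X = "{x \<in> orthant I. \<exists>j. j \<noteq> e \<and> x $ j \<noteq> 0}"
  \<comment> \<open>Large enough for all inequalities at once; the summand 1 makes every tilt strictly positive.\<close>
  define \<kappa> where "\<kappa> i = 1 + (\<Sum>c\<in>A. \<bar>c (axis i 1)\<bar> / c (axis e 1))" for i
  have \<kappa>_pos: "0 < \<kappa> i" for i
    unfolding \<kappa>_def using pos by (intro add_pos_nonneg sum_nonneg) (auto simp: less_imp_le)
  have \<kappa>: "0 \<le> c (axis i 1 + \<kappa> i *\<^sub>R axis e 1)" if c: "c \<in> A" for c i
  proof -
    have "\<bar>c (axis i 1)\<bar> / c (axis e 1) \<le> (\<Sum>c\<in>A. \<bar>c (axis i 1)\<bar> / c (axis e 1))"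
      using A c pos by (intro member_le_sum) (auto simp: less_imp_le)
    then have "\<bar>c (axis i 1)\<bar> / c (axis e 1) \<le> \<kappa> i"
      by (simp add: \<kappa>_def)
    then have "\<bar>c (axis i 1)\<bar> \<le> \<kappa> i * c (axis e 1)"
      using pos[OF c] by (simp add: pos_divide_le_eq)
    then show ?thesis
      by (simp add: linear_add[OF lin[OF c]] linear_cmul[OF lin[OF c]])
  qed
  define m where "m i = (if i = e then axis e 1 else axis i 1 + \<kappa> i *\<^sub>R axis e 1 :: real ^ 'n)" for i
  obtain W0 where W0: "\<forall>w\<in>set W0. \<forall>i\<in>I. w i \<in> ?X" "dissects I (\<lambda>i. axis i 1) UNIV (m # W0)"
    using dissect_around_axis[OF e, of \<kappa>] \<kappa>_pos by (auto simp: m_def[abs_def])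
  have X: "x + k *\<^sub>R y \<in> ?X" if xy: "x \<in> ?X" "y \<in> ?X" "0 < k" for x y k
  proof -
    obtain j where "j \<noteq> e" "x $ j \<noteq> 0"
      using xy(1) by auto
    moreover have "0 \<le> x $ j" "0 \<le> k * y $ j"
      using xy by (auto simp: orthant_def)
    ultimately have "(x + k *\<^sub>R y) $ j \<noteq> 0"
      by simp
    then show ?thesis
      using xy \<open>j \<noteq> e\<close> by (auto simp: orthant_def coordinate_space_def)
  qed
  have "\<forall>w\<in>set W0. \<exists>W. (\<forall>u\<in>set W. u \<in> I \<rightarrow> ?X \<inter> ?K) \<and> dissects I w ?K W"
  proof
    fix w assume "w \<in> set W0"
    then have w: "w \<in> I \<rightarrow> ?X"
      using W0(1) by (simp add: Pi_iff)
    show "\<exists>W. (\<forall>u\<in>set W. u \<in> I \<rightarrow> ?X \<inter> ?K) \<and> dissects I w ?K W"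
      by (rule dissect_polyhedral_cone[OF finite A lin X w])
  qed
  from bchoice[OF this] obtain f where
    f: "\<forall>w\<in>set W0. (\<forall>u\<in>set (f w). u \<in> I \<rightarrow> ?X \<inter> ?K) \<and> dissects I w ?K (f w)"
    by (elim exE)
  define W where "W = concat (map f W0)"
  have W: "w i \<in> ?X \<inter> ?K" if wi: "w \<in> set W" "i \<in> I" for w i
  proof -
    obtain w0 where "w0 \<in> set W0" "w \<in> set (f w0)"
      using wi(1) unfolding W_def by auto
    then have "w \<in> I \<rightarrow> ?X \<inter> ?K"
      using f by blast
    then show ?thesis
      using wi(2) by (rule Pi_mem)
  qed
  have W_nz: "w i \<noteq> 0" if "w \<in> set W" "i \<in> I" for w i
    using W[OF that] by auto
  have m_orthant: "m i \<in> orthant I" and m_K: "m i \<in> ?K" and m_nz: "m i \<noteq> 0" if "i \<in> I" for i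
  proof -
    show "m i \<in> orthant I"
      using that e \<kappa>_pos[of i] by (auto simp: m_def orthant_def coordinate_space_def axis_def)
    show "m i \<in> ?K"
      using \<kappa> pos by (auto simp: m_def less_imp_le)
    have "m i $ i \<noteq> 0"
      by (simp add: m_def axis_def)
    then show "m i \<noteq> 0"
      by (metis zero_index)
  qed
  have m_dissects: "dissects I m ?K [m]"
  proof (rule dissects_trivial)
    fix t :: "'n \<Rightarrow> real" assume t: "\<And>i. i \<in> I \<Longrightarrow> 0 \<le> t i"
    show "(\<Sum>i\<in>I. t i *\<^sub>R m i) \<in> ?K"
    proof clarify
      fix c assume c: "c \<in> A"
      have "c (\<Sum>i\<in>I. t i *\<^sub>R m i) = (\<Sum>i\<in>I. t i * c (m i))"
        by (simp add: linear_sum[OF lin[OF c]] linear_cmul[OF lin[OF c]])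
      also have "0 \<le> \<dots>"
        using t m_K c by (intro sum_nonneg mult_nonneg_nonneg) auto
      finally show "0 \<le> c (\<Sum>i\<in>I. t i *\<^sub>R m i)" .
    qed
  qed
  \<comment> \<open>The main piece already lies in \<open>?K\<close> and is kept as it is.\<close>
  define f' where "f' w = (if w = m then [m] else f w)" for w
  have K_borel: "?K \<in> sets borel"
    using A lin by (rule polyhedral_cone_borel)
  have m_notin: "m \<notin> set W0"
  proof
    assume "m \<in> set W0"
    then obtain j where "j \<noteq> e" "m e $ j \<noteq> 0"
      using W0(1) e by blast
    then show False
      by (simp add: m_def axis_def)
  qed
  have "dissects I (\<lambda>i. axis i 1) (UNIV \<inter> ?K) (concat (map f' (m # W0)))"
    using f m_dissects by (intro dissects_compose[OF W0(2)] K_borel) (auto simp: f'_def)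
  moreover have "map f' W0 = map f W0"
    using m_notin by (auto simp: f'_def)
  ultimately have K_dissects: "dissects I (\<lambda>i. axis i 1) ?K (m # W)"
    by (simp add: W_def f'_def)
  have dissects: "dissects I (\<lambda>i. axis i 1) (orthant I \<inter> ?K) (m # W)"
    unfolding dissects_def
  proof
    fix \<phi> :: "real ^ 'n \<Rightarrow> ennreal" assume \<phi>: "\<phi> \<in> borel_measurable borel"
    have "simplicial_integral I (\<lambda>i. axis i 1) (\<lambda>x. \<phi> x * indicator (orthant I \<inter> ?K) x) =
        simplicial_integral I (\<lambda>i. axis i 1) (\<lambda>x. \<phi> x * indicator ?K x)"
      by (intro simplicial_integral_cong refl arg_cong2[where f = "(*)"])
        (simp add: indicator_def sum_axis_in_orthant_iff)
    then show "simplicial_integral I (\<lambda>i. axis i 1) (\<lambda>x. \<phi> x * indicator (orthant I \<inter> ?K) x) =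
        (\<Sum>w\<leftarrow>m # W. simplicial_integral I w \<phi>)"
      using K_dissects \<phi> unfolding dissects_def by simp
  qed
  have "cone_laplace \<Lambda> (orthant I \<inter> ?K) = (\<Sum>w\<leftarrow>m # W. \<Prod>i\<in>I. inv_linear (w i))"
  proof (rule cone_laplace_dissection[OF \<Lambda> _ _ _ _ dissects])
    show "span (orthant I \<inter> ?K) = coordinate_space I"
    proof (rule span_eq_coordinate_space)
      fix i assume i: "i \<in> I"
      have m_span: "m j \<in> span (orthant I \<inter> ?K)" if "j \<in> I" for j
        using m_orthant[OF that] m_K[OF that] by (intro span_base) auto
      have "axis i 1 = (if i = e then m e else m i - \<kappa> i *\<^sub>R m e)"
        by (simp add: m_def)
      then show "axis i 1 \<in> span (orthant I \<inter> ?K)"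
        using m_span[OF i] m_span[OF e] by (auto intro!: span_diff span_scale)
    qed (auto simp: orthant_def)
    show "orthant I \<inter> ?K \<in> sets borel"
      using K_borel by simp
  qed (use W W_nz m_orthant m_K m_nz in auto)
  also have "\<dots> = (\<Prod>i\<in>I. inv_linear (m i)) + (\<Sum>w\<leftarrow>W. \<Prod>i\<in>I. inv_linear (w i))"
    by simp
  also have "(\<Prod>i\<in>I. inv_linear (m i)) = 1 / rvar e * (\<Prod>i\<in>I - {e}. inv_linear (m i))"
    using e by (subst prod.remove[of _ e]) (auto simp: m_def inv_linear_axis)
  finally have laplace: "rvar e * cone_laplace \<Lambda> (orthant I \<inter> ?K) =
      (\<Prod>i\<in>I - {e}. inv_linear (m i)) + rvar e * (\<Sum>w\<leftarrow>W. \<Prod>i\<in>I. inv_linear (w i))"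
    by (simp add: distrib_left rvar_nonzero)
  have "zero_coord e (m i) = axis i 1" if "i \<in> I - {e}" for i
    using that by (auto simp: zero_coord_def m_def axis_def vec_eq_iff)
  then have "restricts_to e (inv_linear (m i)) (1 / rvar i)" if "i \<in> I - {e}" for i
    using restricts_to_inv_linear[of e "m i"] that by (simp add: inv_linear_axis axis_eq_0_iff)
  then have "restricts_to e (\<Prod>i\<in>I - {e}. inv_linear (m i)) (\<Prod>i\<in>I - {e}. 1 / rvar i)"
    by (rule restricts_to_prod)
  moreover have "restricts_to e (\<Sum>w\<leftarrow>W. \<Prod>i\<in>I. inv_linear (w i))
      (\<Sum>w\<leftarrow>W. \<Prod>i\<in>I. inv_linear (zero_coord e (w i)))"
  proof (intro restricts_to_sum_list restricts_to_prod restricts_to_inv_linear)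
    fix w i assume "w \<in> set W" "i \<in> I"
    then obtain j where "j \<noteq> e" "w i $ j \<noteq> 0"
      using W by blast
    then have "zero_coord e (w i) $ j \<noteq> 0"
      by (simp add: zero_coord_def)
    then show "zero_coord e (w i) \<noteq> 0"
      by (metis zero_index)
  qed
  ultimately have "restricts_to e (rvar e * cone_laplace \<Lambda> (orthant I \<inter> ?K)) ((\<Prod>i\<in>I - {e}. 1 / rvar i) + 0 *
      (\<Sum>w\<leftarrow>W. \<Prod>i\<in>I. inv_linear (zero_coord e (w i))))"
    unfolding laplace by (intro restricts_to_add restricts_to_mult restricts_to_rvar)
  then show ?thesis
    by (simp add: has_residue_iff_restricts_to)
qed

section \<open>Maximal cones of the fans of a nestoid\<close>

lemma maximal_members_eq_image:
  assumes "\<And>N. N \<in> \<M> \<Longrightarrow> U N \<in> K"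
    and "\<And>C. C \<in> K \<Longrightarrow> \<exists>N\<in>\<M>. C \<subseteq> U N"
    and "\<And>N N'. N \<in> \<M> \<Longrightarrow> N' \<in> \<M> \<Longrightarrow> U N \<subseteq> U N' \<Longrightarrow> N = N'"
  shows "maximal_members K = U ` \<M>" "inj_on U \<M>"
proof -
  show "inj_on U \<M>"
    using assms(3) by (auto intro!: inj_onI)
  show "maximal_members K = U ` \<M>"
  proof (intro set_eqI iffI)
    fix C assume C: "C \<in> maximal_members K"
    then obtain N where "N \<in> \<M>" "C \<subseteq> U N"
      using assms(2) unfolding maximal_members_def by blast
    then show "C \<in> U ` \<M>"
      using C assms(1) unfolding maximal_members_def by blast
  next
    fix C assume "C \<in> U ` \<M>"
    then obtain N where N: "N \<in> \<M>" "C = U N" by blast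
    have "C' = U N" if C': "C' \<in> K" "U N \<subseteq> C'" for C'
    proof -
      obtain N' where N': "N' \<in> \<M>" "C' \<subseteq> U N'"
        using assms(2) C'(1) by blast
      then have "N = N'"
        using assms(3)[of N N'] N C' by blast
      then show ?thesis
        using N' C' by blast
    qed
    then show "C \<in> maximal_members K"
      using N assms(1) unfolding maximal_members_def by blast
  qed
qed

lemma laplace_eq_sum:
  assumes "\<And>N. N \<in> \<M> \<Longrightarrow> U N \<in> K"
    and "\<And>C. C \<in> K \<Longrightarrow> \<exists>N\<in>\<M>. C \<subseteq> U N"
    and "\<And>N N'. N \<in> \<M> \<Longrightarrow> N' \<in> \<M> \<Longrightarrow> U N \<subseteq> U N' \<Longrightarrow> N = N'"
  shows "laplace \<Lambda> K = (\<Sum>N\<in>\<M>. cone_laplace \<Lambda> (U N))"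
  using maximal_members_eq_image[of \<M> U K, OF assms]
  by (simp add: laplace_def sum.reindex)

lemma maximal_members_subset_eq:
  "M \<in> maximal_members K \<Longrightarrow> M' \<in> maximal_members K \<Longrightarrow> M \<subseteq> M' \<Longrightarrow> M = M'"
  by (auto simp: maximal_members_def)

text \<open>
  The top element is comparable to everything, so it occurs in no set of two or more pairwise
  incomparable elements.
\<close>

lemma nested_sets_insert_top:
  assumes "top \<in> G" "N \<in> nested_sets G"
  shows "insert top N \<in> nested_sets G"
  unfolding nested_sets_def mem_Collect_eq
proof (intro conjI allI impI)
  show "insert top N \<subseteq> G"
    using assms by (auto simp: nested_sets_def)
  fix S assume S: "S \<subseteq> insert top N" "2 \<le> card S \<and> pairwise incomparable S"
  have "top \<notin> S"
  proof
    assume top: "top \<in> S"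
    have "\<not> S \<subseteq> {top}"
      using S(2) card_mono[of "{top}" S] by auto
    then obtain s where "s \<in> S" "s \<noteq> top" by blast
    then have "incomparable s top"
      using S(2) top by (auto simp: pairwise_def)
    then show False
      by (simp add: incomparable_def)
  qed
  then show "\<Squnion>\<^sub>f\<^sub>i\<^sub>n S \<notin> G"
    using S assms(2) by (auto simp: nested_sets_def)
qed

lemma top_in_maximal_nested_set:
  assumes "top \<in> G" "N \<in> maximal_members (nested_sets G)"
  shows "top \<in> N"
  using assms nested_sets_insert_top[of G N] by (auto simp: maximal_members_def)

lemma nested_set_subset_maximal:
  assumes "N \<in> nested_sets G"
  shows "\<exists>M\<in>maximal_members (nested_sets G). N \<subseteq> M"
  using finite_has_maximal2[of "nested_sets G" N] assms by (auto simp: maximal_members_def)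

lemma convex_cone_orthant: "convex_cone (orthant I)"
  by (auto simp: convex_cone_iff orthant_def coordinate_space_def)

lemma convex_cone_hull_axes: "convex_cone hull ((\<lambda>i. axis i 1) ` I) = orthant I"
proof (rule hull_unique)
  fix T assume T: "(\<lambda>i. axis i (1::real)) ` I \<subseteq> T" "convex_cone T"
  show "orthant I \<subseteq> T"
  proof
    fix x assume x: "x \<in> orthant I"
    have "(\<Sum>i\<in>J. (x $ i) *\<^sub>R axis i 1) \<in> T" if "J \<subseteq> I" for J
      using finite[of J] that
    proof (induction J rule: finite_induct)
      case empty
      then show ?case
        using T(2) by (simp add: convex_cone_contains_0)
    next
      case (insert j J)
      then show ?case
        using T x by (auto simp: orthant_def intro!: convex_cone_add convex_cone_scaleR)
    qed
    from this[of I] show "x \<in> T"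
      using x by (simp add: orthant_def coordinate_space_expand)
  qed
qed (auto intro: axis_in_orthant convex_cone_orthant)

lemma axis_in_orthant_iff: "axis i 1 \<in> orthant I \<longleftrightarrow> i \<in> I"
proof
  assume "axis i 1 \<in> orthant I"
  then have "i \<notin> I \<longrightarrow> axis i (1::real) $ i = 0"
    unfolding orthant_def coordinate_space_def by blast
  then show "i \<in> I"
    by (simp add: axis_def)
qed (rule axis_in_orthant)

lemma orthant_subset_iff: "orthant I \<subseteq> orthant J \<longleftrightarrow> I \<subseteq> J"
proof
  show "I \<subseteq> J" if "orthant I \<subseteq> orthant J"
    using that axis_in_orthant_iff by blast
qed (auto simp: orthant_def coordinate_space_def)

lemma signed_basis_eq: "signed_basis N = (\<lambda>i. axis i 1) ` (N \<times> UNIV)"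
  by (auto simp: signed_basis_def UNIV_bool)

lemma signed_cone_eq: "convex_cone hull signed_basis N = orthant (N \<times> UNIV)"
  by (simp add: signed_basis_eq convex_cone_hull_axes)

lemma mem_faces_of_cones:
  assumes "C \<in> K" "convex C" "C \<noteq> {}"
  shows "C \<in> faces_of_cones K"
  using assms face_of_refl[of C] by (auto simp: faces_of_cones_def)

lemma orthant_in_signed_fan:
  assumes "N \<in> nested_sets G"
  shows "orthant (N \<times> UNIV) \<in> signed_fan G"
  unfolding signed_fan_def signed_cone_eq
  using assms convex_cone_orthant[of "N \<times> UNIV"]
  by (intro mem_faces_of_cones) (auto simp: convex_cone_def)

lemma signed_fan_subset_orthant:
  assumes "C \<in> signed_fan G"
  shows "\<exists>N\<in>maximal_members (nested_sets G). C \<subseteq> orthant (N \<times> UNIV)"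
proof -
  obtain N where N: "N \<in> nested_sets G" "C \<subseteq> orthant (N \<times> UNIV)"
    using assms by (auto simp: signed_fan_def signed_cone_eq faces_of_cones_def dest: face_of_imp_subset)
  obtain M where "M \<in> maximal_members (nested_sets G)" "N \<subseteq> M"
    using nested_set_subset_maximal[OF N(1)] by blast
  moreover from this have "orthant (N \<times> UNIV) \<subseteq> orthant (M \<times> UNIV)"
    by (auto simp: orthant_subset_iff)
  ultimately show ?thesis
    using N(2) by blast
qed

lemma signed_lattice_eq: "signed_lattice G = integer_points (G \<times> UNIV)"
proof -
  have *: "integer_points (G \<times> UNIV) \<inter> coordinate_space (G \<times> UNIV) = integer_points (G \<times> UNIV)"
    by (auto simp: integer_points_def)
  show ?thesis
    using lattice_basis_axes[OF *] unfolding lattice_basis_def * signed_lattice_def signed_basis_eq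
    by (elim conjE) (rule sym)
qed

lemma integer_points_Int_coordinate_space:
  "I \<subseteq> J \<Longrightarrow> integer_points J \<inter> coordinate_space I = integer_points I"
  by (auto simp: integer_points_def coordinate_space_def)

lemma prod_inverse_rvar:
  "(\<Prod>i\<in>N \<times> UNIV. 1 / rvar i) = (\<Prod>f\<in>N. 1 / (E_plus f * E_minus f))"
proof -
  have "(\<Prod>i\<in>N \<times> UNIV. 1 / rvar i) = (\<Prod>f\<in>N. \<Prod>b\<in>UNIV. 1 / rvar (f, b))"
    by (subst prod.cartesian_product) (simp add: case_prod_unfold)
  also have "\<dots> = (\<Prod>f\<in>N. 1 / (E_plus f * E_minus f))"
    by (simp add: UNIV_bool mult.commute)
  finally show ?thesis .
qed

section \<open>The universe fan\<close>

lemma linear_F_form: "linear (F_form G g)"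
  unfolding F_form_def
  by (rule linearI)
     (simp_all add: sum.distrib sum_subtractf algebra_simps flip: sum_distrib_left)

lemma F_form_plus_top: "F_form G g (plus_vec top) = 1"
proof -
  have "(\<Sum>f\<in>{f\<in>G. g < f \<and> f < top}. p_coord (plus_vec top) f - m_coord (plus_vec top) f) = (0::real)"
    by (intro sum.neutral) (auto simp: axis_def)
  then show ?thesis
    by (simp add: F_form_def) (simp add: axis_def)
qed

lemma F_form_plus_nonneg: "0 \<le> F_form G g (plus_vec f)"
proof -
  have "0 \<le> (\<Sum>h\<in>{h\<in>G. g < h \<and> h < top}. p_coord (plus_vec f) h - m_coord (plus_vec f) h)"
    by (intro sum_nonneg) (auto simp: axis_def)
  moreover have "0 \<le> p_coord (plus_vec f) top" "m_coord (plus_vec f) g = 0"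
    by (auto simp: axis_def)
  ultimately show ?thesis
    by (simp add: F_form_def)
qed

lemma plus_in_causal_cone: "f \<in> G \<Longrightarrow> plus_vec f \<in> causal_cone G"
  unfolding causal_cone_def signed_basis_eq span_axes
  by (auto simp: F_form_plus_nonneg axis_in_coordinate_space) (auto simp: axis_def)

text \<open>
  The equation \<open>m_coord x top = 0\<close> only removes one coordinate, and the sign conditions of the causal cone
  are those of the orthant.
\<close>

lemma orthant_Int_causal_cone:
  assumes "N \<subseteq> G" "top \<in> G"
  shows "orthant (N \<times> UNIV) \<inter> causal_cone G =
    orthant (N \<times> UNIV - {(top, False)}) \<inter> {x. \<forall>c\<in>F_form G ` G. 0 \<le> c x}"
  unfolding causal_cone_def signed_basis_eq span_axes orthant_def coordinate_space_def
  using assms by auto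

lemma convex_polyhedral_cone:
  fixes A :: "('v::real_vector \<Rightarrow> real) set"
  assumes "\<And>c. c \<in> A \<Longrightarrow> linear c"
  shows "convex {x. \<forall>c\<in>A. 0 \<le> c x}"
  using assms by (auto intro!: convexI simp: linear_add linear_cmul)

text \<open>
  The vectors \<open>plus_vec f\<close> with \<open>f \<in> G\<close> all lie in the causal cone, so the cone of a nested set still
  determines the set after the intersection.
\<close>

lemma laplace_universe_fan:
  fixes G :: "'a::{finite, bounded_lattice} set"
  assumes top: "top \<in> G"
  shows "laplace \<Lambda> (universe_fan G) =
    (\<Sum>N\<in>maximal_members (nested_sets G). cone_laplace \<Lambda> (orthant (N \<times> UNIV) \<inter> causal_cone G))"
proof (rule laplace_eq_sum)
  fix N assume N: "N \<in> maximal_members (nested_sets G)"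
  then have "N \<in> nested_sets G" "N \<subseteq> G"
    by (auto simp: maximal_members_def nested_sets_def)
  moreover have "convex (orthant (N \<times> UNIV) \<inter> causal_cone G)"
    unfolding orthant_Int_causal_cone[OF \<open>N \<subseteq> G\<close> top]
    using convex_cone_orthant linear_F_form
    by (intro convex_Int convex_polyhedral_cone) (auto simp: convex_cone_def)
  moreover have "orthant (N \<times> UNIV) \<inter> causal_cone G \<noteq> {}"
    using plus_in_causal_cone[OF top] top_in_maximal_nested_set[OF top N]
      axis_in_orthant[of "(top, True)" "N \<times> UNIV"] by auto
  ultimately show "orthant (N \<times> UNIV) \<inter> causal_cone G \<in> universe_fan G"
    unfolding universe_fan_def using orthant_in_signed_fan by (intro mem_faces_of_cones) blast+
next
  fix C assume "C \<in> universe_fan G"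
  then obtain D where "D \<in> signed_fan G" "C \<subseteq> D \<inter> causal_cone G"
    by (auto simp: universe_fan_def faces_of_cones_def dest!: face_of_imp_subset)
  then show "\<exists>N\<in>maximal_members (nested_sets G). C \<subseteq> orthant (N \<times> UNIV) \<inter> causal_cone G"
    using signed_fan_subset_orthant by blast
next
  fix N N' assume N: "N \<in> maximal_members (nested_sets G)" "N' \<in> maximal_members (nested_sets G)"
    and sub: "orthant (N \<times> UNIV) \<inter> causal_cone G \<subseteq> orthant (N' \<times> UNIV) \<inter> causal_cone G"
  have "N \<subseteq> N'"
  proof
    fix f assume f: "f \<in> N"
    then have "f \<in> G"
      using N by (auto simp: maximal_members_def nested_sets_def)
    then have "plus_vec f \<in> orthant (N' \<times> UNIV)"
      using sub plus_in_causal_cone[of f G] axis_in_orthant[of "(f, True)" "N \<times> UNIV"] f by auto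
    then show "f \<in> N'"
      by (simp add: axis_in_orthant_iff)
  qed
  then show "N = N'"
    using N by (intro maximal_members_subset_eq)
qed

section \<open>The link of the cone spanned by the two top vectors\<close>

lemma orthogonal_comp_coordinate_space: "(coordinate_space J)\<^sup>\<bottom> = coordinate_space (- J)"
proof
  show "(coordinate_space J)\<^sup>\<bottom> \<subseteq> coordinate_space (- J)"
  proof
    fix x assume x: "x \<in> (coordinate_space J)\<^sup>\<bottom>"
    have "x $ i = 0" if "i \<in> J" for i
    proof -
      have "orthogonal (axis i 1) x"
        using x axis_in_coordinate_space[OF that] by (auto simp: orthogonal_comp_def)
      then show ?thesis
        by (simp add: orthogonal_def inner_axis')
    qed
    then show "x \<in> coordinate_space (- J)"
      by (simp add: coordinate_space_def)
  qed
  show "coordinate_space (- J) \<subseteq> (coordinate_space J)\<^sup>\<bottom>"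
    unfolding orthogonal_comp_def orthogonal_def inner_vec_def coordinate_space_def
    by (fastforce intro!: sum.neutral)
qed

lemma quotient_proj_coordinate_space:
  "quotient_proj (coordinate_space J) = (\<lambda>x. \<chi> i. if i \<in> J then 0 else x $ i)"
  unfolding quotient_proj_def orthogonal_comp_coordinate_space
  by (intro ext the_equality) (auto simp: coordinate_space_def vec_eq_iff)

lemma quotient_proj_image_orthant:
  "quotient_proj (coordinate_space J) ` orthant I = orthant (I - J)"
  unfolding quotient_proj_coordinate_space
proof
  show "orthant (I - J) \<subseteq> (\<lambda>x. \<chi> i. if i \<in> J then 0 else x $ i) ` orthant I"
  proof
    fix x assume "x \<in> orthant (I - J)"
    then have "x = (\<chi> i. if i \<in> J then 0 else x $ i)" "x \<in> orthant I"
      by (auto simp: orthant_def coordinate_space_def vec_eq_iff)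
    then show "x \<in> (\<lambda>x. \<chi> i. if i \<in> J then 0 else x $ i) ` orthant I"
      by blast
  qed
qed (auto simp: orthant_def coordinate_space_def)

lemma quotient_proj_image_integer_points:
  "quotient_proj (coordinate_space J) ` integer_points I = integer_points (I - J)"
  unfolding quotient_proj_coordinate_space
proof
  show "integer_points (I - J) \<subseteq> (\<lambda>x. \<chi> i. if i \<in> J then 0 else x $ i) ` integer_points I"
  proof
    fix x assume "x \<in> integer_points (I - J)"
    then have "x = (\<chi> i. if i \<in> J then 0 else x $ i)" "x \<in> integer_points I"
      by (auto simp: integer_points_def coordinate_space_def vec_eq_iff)
    then show "x \<in> (\<lambda>x. \<chi> i. if i \<in> J then 0 else x $ i) ` integer_points I"
      by blast
  qed
qed (auto simp: integer_points_def coordinate_space_def)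

lemma top_vectors_eq: "{plus_vec f, minus_vec f} = signed_basis {f}"
  by (auto simp: signed_basis_def)

text \<open>
  Every maximal nested set contains \<open>top\<close>, so all maximal cones of the fan contain the two top vectors and
  have an image in the link.
\<close>

lemma laplace_link:
  fixes G :: "'a::{finite, bounded_lattice} set"
  assumes top: "top \<in> G"
  shows "laplace \<Lambda> (link (signed_fan G) (signed_basis {top})) =
    (\<Sum>N\<in>maximal_members (nested_sets G). cone_laplace \<Lambda> (orthant ((N - {top}) \<times> UNIV)))"
proof (rule laplace_eq_sum)
  let ?T = "{top} \<times> UNIV :: ('a \<times> bool) set"
  have link: "link (signed_fan G) (signed_basis {top}) =
      {quotient_proj (coordinate_space ?T) ` C | C. C \<in> signed_fan G \<and> orthant ?T \<subseteq> C}"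
    unfolding link_def signed_cone_eq by (simp add: signed_basis_eq span_axes)
  have proj: "quotient_proj (coordinate_space ?T) ` orthant (N \<times> UNIV) = orthant ((N - {top}) \<times> UNIV)" for N
    by (simp add: quotient_proj_image_orthant Times_Diff_distrib1)
  {
    fix N assume N: "N \<in> maximal_members (nested_sets G)"
    then have "orthant (N \<times> UNIV) \<in> signed_fan G"
      by (intro orthant_in_signed_fan) (simp add: maximal_members_def)
    moreover have "orthant ?T \<subseteq> orthant (N \<times> UNIV)"
      using top_in_maximal_nested_set[OF top N] by (auto simp: orthant_subset_iff)
    ultimately show "orthant ((N - {top}) \<times> UNIV) \<in> link (signed_fan G) (signed_basis {top})"
      unfolding link proj[symmetric] by blast
  next
    fix C assume "C \<in> link (signed_fan G) (signed_basis {top})"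
    then obtain D where D: "D \<in> signed_fan G" "C = quotient_proj (coordinate_space ?T) ` D"
      unfolding link by blast
    then show "\<exists>N\<in>maximal_members (nested_sets G). C \<subseteq> orthant ((N - {top}) \<times> UNIV)"
      unfolding proj[symmetric] using signed_fan_subset_orthant[OF D(1)] by blast
  next
    fix N N' assume N: "N \<in> maximal_members (nested_sets G)" "N' \<in> maximal_members (nested_sets G)"
      and sub: "orthant ((N - {top}) \<times> (UNIV :: bool set)) \<subseteq> orthant ((N' - {top}) \<times> UNIV)"
    have "N \<subseteq> N'"
      using sub top_in_maximal_nested_set[OF top N(2)] by (auto simp: orthant_subset_iff)
    then show "N = N'"
      using N by (intro maximal_members_subset_eq)
  }
qed

theorem corollary3p10:
  fixes G :: "'a::{finite, bounded_lattice} set"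
  assumes "nestoid G"
  shows "has_residue (top, True) (wavefunction G) (amplitude_E G) \<and>
         amplitude_E G =
           laplace (quotient_proj (span {plus_vec top, minus_vec top}) ` signed_lattice G)
                   (link (signed_fan G) {plus_vec top, minus_vec top})"
proof -
  let ?e = "(top, True) :: 'a \<times> bool" and ?\<M> = "maximal_members (nested_sets G)"
  have top: "top \<in> G"
    using assms by (simp add: nestoid_def nestable_def)
  have amplitude: "amplitude_E G = (\<Sum>N\<in>?\<M>. \<Prod>i\<in>(N - {top}) \<times> UNIV. 1 / rvar i)"
    by (simp add: amplitude_E_def nestoid_amplitude_def prod_inverse_rvar)
  have "has_residue ?e (cone_laplace (signed_lattice G) (orthant (N \<times> UNIV) \<inter> causal_cone G))
      (\<Prod>i\<in>(N - {top}) \<times> UNIV. 1 / rvar i)" if N: "N \<in> ?\<M>" for N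
  proof -
    \<comment> \<open>The coordinate \<open>m_coord x top\<close> is zero on the causal cone.\<close>
    let ?I = "N \<times> UNIV - {(top, False)}"
    have "N \<subseteq> G" "top \<in> N"
      using N top_in_maximal_nested_set[OF top N] by (auto simp: maximal_members_def nested_sets_def)
    then have "signed_lattice G \<inter> coordinate_space ?I = integer_points ?I"
      unfolding signed_lattice_eq by (intro integer_points_Int_coordinate_space) auto
    then have "has_residue ?e
        (cone_laplace (signed_lattice G) (orthant ?I \<inter> {x. \<forall>c\<in>F_form G ` G. 0 \<le> c x}))
        (\<Prod>i\<in>?I - {?e}. 1 / rvar i)"
      using \<open>top \<in> N\<close> by (intro residue_cone_laplace) (auto simp: linear_F_form F_form_plus_top)
    moreover have "?I - {?e} = (N - {top}) \<times> UNIV"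
      by auto
    ultimately show ?thesis
      using orthant_Int_causal_cone[OF \<open>N \<subseteq> G\<close> top] by simp
  qed
  then have "has_residue ?e (wavefunction G) (amplitude_E G)"
    unfolding wavefunction_def laplace_universe_fan[OF top] amplitude has_residue_iff_restricts_to
      sum_distrib_left
    by (rule restricts_to_sum)
  moreover have "quotient_proj (span (signed_basis {top})) ` signed_lattice G =
      integer_points ((G - {top}) \<times> UNIV)"
    by (simp add: signed_lattice_eq signed_basis_eq span_axes quotient_proj_image_integer_points
        Times_Diff_distrib1)
  moreover have "cone_laplace (integer_points ((G - {top}) \<times> (UNIV :: bool set)))
        (orthant ((N - {top}) \<times> UNIV)) = (\<Prod>i\<in>(N - {top}) \<times> UNIV. 1 / rvar i)" if "N \<in> ?\<M>" for N
    using that by (intro cone_laplace_orthant integer_points_Int_coordinate_space)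
      (auto simp: maximal_members_def nested_sets_def)
  ultimately show ?thesis
    unfolding top_vectors_eq laplace_link[OF top] amplitude by simp
qed

end
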